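(* There exists a deterministic algorithm which, on input $T(G,\lambda)$, where $G = (V,E)$ is a graph of maximum degree $\Delta(G) \in o(\sqrt{|E|})$ and $\lambda : V \to \{0,1\}$ is any odd charge labeling, produces a tree-like resolution refutation of $T(G,\lambda)$ in time $$|E|^{O(1)}\, 2^{\left(1 - 2\left(1 - \frac{1}{\sqrt 2}\right)^2\right)|E| + o(|E|)} \le 2^{0.83|E|},$$ where the last inequality holds for $|E|$ sufficiently large.
   Context: Graphs are finite and simple. For a graph $G = (V,E)$ and $\lambda : V \to \{0,1\}$, the Tseitin formula $T(G,\lambda)$ has a Boolean variable $x_e$ for every edge $e \in E$ and states that for every $v \in V$, $\bigoplus_{e \ni v} x_e = \lambda(v)$ (sum modulo 2). The labeling $\lambda$ is called an odd charge labeling if $\bigoplus_{v \in V}\lambda(v) = 1$; in that case $T(G,\lambda)$ is unsatisfiable. As a formula to be refuted, $T(G,\lambda)$ denotes its CNF representation: each vertex constraint is written as the conjunction of all clauses on the variables $x_e$, $e \ni v$, that are falsified exactly by one of the assignments violating the constraint. A tree-like resolution refutation is a resolution refutation whose underlying derivation graph is a tree; equivalently it can be given by a decision tree for the CNF, i.e. a rooted binary tree whose inner nodes are labeled by variables, whose edges are labeled by $0/1$ (the value of the variable queried at the node they come out of), and whose leaves are labeled by clauses falsified by the partial assignment along the path from the root to the leaf. Asymptotic notation is as $|E|\to\infty$; the $o(|E|)$ term depends only on the function of $|E|$ bounding $\Delta(G)$. *)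

theory Defs
  imports Complex_Main "HOL-Library.Z2" "HOL-Library.Landau_Symbols"
begin

section \<open>CNF formulas and tree-like resolution\<close>

datatype 'v literal = Pos (var: 'v) | Neg (var: 'v)

type_synonym 'v clause = "'v literal set"
type_synonym 'v cnf = "'v clause set"

definition resolvent :: "'v clause \<Rightarrow> 'v clause \<Rightarrow> 'v clause \<Rightarrow> bool" where
  "resolvent C C1 C2 \<longleftrightarrow>
     (\<exists>x. Pos x \<in> C1 \<and> Neg x \<in> C2 \<and> C = (C1 - {Pos x}) \<union> (C2 - {Neg x}))"

text \<open>Every node of a derivation tree carries the clause derived there. The type is polymorphic in
  the representation of clauses: literal sets for the proof system, literal lists for the
  output of an algorithm.\<close>

datatype 'c proof_tree =
    Initial (concl: 'c)
  | Resolve (concl: 'c) "'c proof_tree" "'c proof_tree"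

fun derivation :: "'v cnf \<Rightarrow> 'v clause proof_tree \<Rightarrow> bool" where
  "derivation F (Initial C) \<longleftrightarrow> C \<in> F"
| "derivation F (Resolve C R1 R2) \<longleftrightarrow>
     derivation F R1 \<and> derivation F R2 \<and> resolvent C (concl R1) (concl R2)"

definition tree_resolution_refutation :: "'v cnf \<Rightarrow> 'v clause proof_tree \<Rightarrow> bool" where
  "tree_resolution_refutation F R \<longleftrightarrow> derivation F R \<and> concl R = {}"


section \<open>Tseitin formulas\<close>

text \<open>Vertices are natural numbers, edges are two-element sets of vertices.\<close>

definition simple_graph :: "nat set \<Rightarrow> nat set set \<Rightarrow> bool" where
  "simple_graph V E \<longleftrightarrow> finite V \<and> (\<forall>e\<in>E. e \<subseteq> V \<and> card e = 2)"

definition incident :: "nat set set \<Rightarrow> nat \<Rightarrow> nat set set" where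
  "incident E v = {e \<in> E. v \<in> e}"

definition max_degree :: "nat set \<Rightarrow> nat set set \<Rightarrow> nat" where
  "max_degree V E = Max ((\<lambda>v. card (incident E v)) ` V)"

text \<open>The type \<^typ>\<open>bit\<close> is the field with two elements, so sums are taken modulo 2.\<close>

definition odd_charge :: "nat set \<Rightarrow> (nat \<Rightarrow> bit) \<Rightarrow> bool" where
  "odd_charge V c \<longleftrightarrow> (\<Sum>v\<in>V. c v) = 1"

definition vertex_constraint ::
    "nat set set \<Rightarrow> (nat \<Rightarrow> bit) \<Rightarrow> nat \<Rightarrow> (nat set \<Rightarrow> bit) \<Rightarrow> bool" where
  "vertex_constraint E c v x \<longleftrightarrow> (\<Sum>e\<in>incident E v. x e) = c v"

definition falsified_clause :: "'v set \<Rightarrow> ('v \<Rightarrow> bit) \<Rightarrow> 'v clause" where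
  "falsified_clause I x = (\<lambda>i. if x i = 1 then Neg i else Pos i) ` I"

definition tseitin :: "nat set \<Rightarrow> nat set set \<Rightarrow> (nat \<Rightarrow> bit) \<Rightarrow> nat set cnf" where
  "tseitin V E c =
     {falsified_clause (incident E v) x | v x. v \<in> V \<and> \<not> vertex_constraint E c v x}"

primrec sat_literal :: "('v \<Rightarrow> bit) \<Rightarrow> 'v literal \<Rightarrow> bool" where
  "sat_literal x (Pos i) \<longleftrightarrow> x i = 1"
| "sat_literal x (Neg i) \<longleftrightarrow> x i = 0"

lemma tseitin_satisfied_iff:
  "(\<forall>C\<in>tseitin V E c. \<exists>l\<in>C. sat_literal x l) \<longleftrightarrow> (\<forall>v\<in>V. vertex_constraint E c v x)"
proof (intro iffI ballI)
  fix v assume sat: "\<forall>C\<in>tseitin V E c. \<exists>l\<in>C. sat_literal x l" and "v \<in> V"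
  show "vertex_constraint E c v x"
  proof (rule ccontr)
    assume "\<not> vertex_constraint E c v x"
    with \<open>v \<in> V\<close> have "falsified_clause (incident E v) x \<in> tseitin V E c"
      unfolding tseitin_def by blast
    with sat obtain l where "l \<in> falsified_clause (incident E v) x" "sat_literal x l"
      by blast
    then show False
      by (auto simp: falsified_clause_def split: if_splits)
  qed
next
  fix C assume ok: "\<forall>v\<in>V. vertex_constraint E c v x" and "C \<in> tseitin V E c"
  then obtain v y where v: "v \<in> V" and y: "\<not> vertex_constraint E c v y"
    and C: "C = falsified_clause (incident E v) y"
    unfolding tseitin_def by blast
  have "\<exists>e\<in>incident E v. x e \<noteq> y e"
  proof (rule ccontr)
    assume "\<not> ?thesis"
    then have "(\<Sum>e\<in>incident E v. x e) = (\<Sum>e\<in>incident E v. y e)"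
      by (intro sum.cong) auto
    with ok v y show False
      by (simp add: vertex_constraint_def)
  qed
  then obtain e where e: "e \<in> incident E v" "x e \<noteq> y e"
    by blast
  then have "(if y e = 1 then Neg e else Pos e) \<in> C"
    unfolding C falsified_clause_def by blast
  moreover have "sat_literal x (if y e = 1 then Neg e else Pos e)"
    using e(2) by (cases "x e"; cases "y e") auto
  ultimately show "\<exists>l\<in>C. sat_literal x l"
    by blast
qed

definition rename :: "('v \<Rightarrow> 'w) \<Rightarrow> 'v cnf \<Rightarrow> 'w cnf" where
  "rename f F = (\<lambda>C. map_literal f ` C) ` F"

text \<open>A formula is written down as a list of clauses, each a list of literals, in any order
  and without repetitions.\<close>

definition lists_cnf :: "'v literal list list \<Rightarrow> 'v cnf \<Rightarrow> bool" where
  "lists_cnf cs F \<longleftrightarrow> set (map set cs) = F \<and> distinct (map set cs) \<and> (\<forall>c\<in>set cs. distinct c)"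


section \<open>Algorithms and their running time\<close>

text \<open>Algorithms are programs of a first-order functional language over binary trees (pure
  first-order Lisp). Expressions refer to the local environment by position, and
  \<open>Call f es\<close> invokes the \<open>f\<close>-th function body of the program with the values of \<open>es\<close> as its
  environment. In \<open>IfE b e1 e2\<close> the tree \<open>Atom\<close> counts as false, every other tree as true.\<close>

datatype data = Atom | Node data data

datatype expr =
    Arg nat
  | AtomE
  | NodeE expr expr
  | Fst expr
  | Snd expr
  | IfE expr expr expr
  | LetE expr expr
  | Call nat "expr list"

type_synonym program = "expr list"

fun first :: "data \<Rightarrow> data" where
  "first Atom = Atom"
| "first (Node a b) = a"

fun second :: "data \<Rightarrow> data" where
  "second Atom = Atom"
| "second (Node a b) = b"

text \<open>\<open>eval P r e v t\<close>: in environment \<open>r\<close>, expression \<open>e\<close> evaluates to \<open>v\<close> in \<open>t\<close> steps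
  (call by value). Each step takes constant time on a pointer machine, where a tree is
  represented by a pointer to its root and subtrees are shared.\<close>

inductive eval :: "program \<Rightarrow> data list \<Rightarrow> expr \<Rightarrow> data \<Rightarrow> nat \<Rightarrow> bool"
  and evals :: "program \<Rightarrow> data list \<Rightarrow> expr list \<Rightarrow> data list \<Rightarrow> nat \<Rightarrow> bool"
  for P :: program
where
  eval_Arg: "i < length r \<Longrightarrow> eval P r (Arg i) (r ! i) 1"
| eval_Atom: "eval P r AtomE Atom 1"
| eval_Node: "eval P r e1 v1 t1 \<Longrightarrow> eval P r e2 v2 t2
    \<Longrightarrow> eval P r (NodeE e1 e2) (Node v1 v2) (t1 + t2 + 1)"
| eval_Fst: "eval P r e v t \<Longrightarrow> eval P r (Fst e) (first v) (t + 1)"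
| eval_Snd: "eval P r e v t \<Longrightarrow> eval P r (Snd e) (second v) (t + 1)"
| eval_If_true: "eval P r b u s \<Longrightarrow> u \<noteq> Atom \<Longrightarrow> eval P r e1 v t
    \<Longrightarrow> eval P r (IfE b e1 e2) v (s + t + 1)"
| eval_If_false: "eval P r b Atom s \<Longrightarrow> eval P r e2 v t
    \<Longrightarrow> eval P r (IfE b e1 e2) v (s + t + 1)"
| eval_Let: "eval P r e1 u s \<Longrightarrow> eval P (u # r) e2 v t
    \<Longrightarrow> eval P r (LetE e1 e2) v (s + t + 1)"
| eval_Call: "evals P r es vs s \<Longrightarrow> f < length P \<Longrightarrow> eval P vs (P ! f) v t
    \<Longrightarrow> eval P r (Call f es) v (s + t + 1)"
| evals_Nil: "evals P r [] [] 0"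
| evals_Cons: "eval P r e v s \<Longrightarrow> evals P r es vs t
    \<Longrightarrow> evals P r (e # es) (v # vs) (s + t)"

inductive_cases eval_elims:
  "eval P r (Arg i) v t" "eval P r AtomE v t" "eval P r (NodeE e1 e2) v t"
  "eval P r (Fst e) v t" "eval P r (Snd e) v t" "eval P r (IfE b e1 e2) v t"
  "eval P r (LetE e1 e2) v t" "eval P r (Call f es) v t"
inductive_cases evals_elims: "evals P r [] vs t" "evals P r (e # es) vs t"

lemma eval_deterministic:
  "eval P r e v t \<Longrightarrow> eval P r e v' t' \<Longrightarrow> v' = v \<and> t' = t"
  "evals P r es vs s \<Longrightarrow> evals P r es vs' s' \<Longrightarrow> vs' = vs \<and> s' = s"
proof (induction arbitrary: v' t' and vs' s' rule: eval_evals.inducts)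
  case eval_Arg
  from eval_Arg.prems show ?case
    by (rule eval_elims) simp
next
  case eval_Atom
  from eval_Atom.prems show ?case
    by (rule eval_elims) simp
next
  case eval_Node
  from eval_Node.prems show ?case
    by (rule eval_elims) (auto dest!: eval_Node.IH(2) eval_Node.IH(4))
next
  case eval_Fst
  from eval_Fst.prems show ?case
    by (rule eval_elims) (auto dest!: eval_Fst.IH(2))
next
  case eval_Snd
  from eval_Snd.prems show ?case
    by (rule eval_elims) (auto dest!: eval_Snd.IH(2))
next
  case eval_If_true
  from eval_If_true.prems show ?case
    by (rule eval_elims) (auto dest!: eval_If_true.IH(2) eval_If_true.IH(4)
        simp: eval_If_true.hyps)
next
  case eval_If_false
  from eval_If_false.prems show ?case
    by (rule eval_elims) (auto dest!: eval_If_false.IH(2) eval_If_false.IH(4))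
next
  case eval_Let
  from eval_Let.prems show ?case
    by (rule eval_elims) (auto dest!: eval_Let.IH(2) eval_Let.IH(4))
next
  case eval_Call
  from eval_Call.prems show ?case
    by (rule eval_elims) (auto dest!: eval_Call.IH(2) eval_Call.IH(5))
next
  case evals_Nil
  from evals_Nil.prems show ?case
    by (rule evals_elims) simp
next
  case evals_Cons
  from evals_Cons.prems show ?case
    by (rule evals_elims) (auto dest!: evals_Cons.IH(2) evals_Cons.IH(4))
qed

text \<open>Sharing lets a program build a tree with exponentially many
  nodes in linearly many steps. Since the result must be written out in full as a tree, one unit
  of time is charged for each of its \<^const>\<open>Node\<close> nodes (this is \<^term>\<open>size y\<close>), in addition
  to the evaluation steps.\<close>

definition computes_in_time :: "program \<Rightarrow> data \<Rightarrow> data \<Rightarrow> nat \<Rightarrow> bool" where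
  "computes_in_time P x y t \<longleftrightarrow> P \<noteq> [] \<and> (\<exists>s. eval P [x] (P ! 0) y s \<and> t = s + size y)"

lemma computes_in_time_deterministic:
  "computes_in_time P x y t \<Longrightarrow> computes_in_time P x y' t' \<Longrightarrow> y' = y \<and> t' = t"
  unfolding computes_in_time_def by (metis eval_deterministic(1))


section \<open>Input and output encodings\<close>

fun enc_list :: "('a \<Rightarrow> data) \<Rightarrow> 'a list \<Rightarrow> data" where
  "enc_list f [] = Atom"
| "enc_list f (x # xs) = Node (f x) (enc_list f xs)"

text \<open>Variables are numbered and written in unary.\<close>

fun enc_nat :: "nat \<Rightarrow> data" where
  "enc_nat 0 = Atom"
| "enc_nat (Suc n) = Node Atom (enc_nat n)"

fun enc_literal :: "nat literal \<Rightarrow> data" where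
  "enc_literal (Pos i) = Node (Node Atom Atom) (enc_nat i)"
| "enc_literal (Neg i) = Node Atom (enc_nat i)"

definition enc_clause :: "nat literal list \<Rightarrow> data" where
  "enc_clause = enc_list enc_literal"

definition enc_cnf :: "nat literal list list \<Rightarrow> data" where
  "enc_cnf = enc_list enc_clause"

fun enc_proof :: "nat literal list proof_tree \<Rightarrow> data" where
  "enc_proof (Initial c) = Node Atom (enc_clause c)"
| "enc_proof (Resolve c R1 R2) = Node (Node (enc_proof R1) (enc_proof R2)) (enc_clause c)"

end

theory Submission
  imports Defs "HOL-Library.Multiset"
begin

text \<open>Partition the vertices into two sides such that about a fifth of the edges lie within each
  side. Search for a falsified clause by branching first on the edges between the sides, then on
  those within the left one, then on those within the right one, and do not branch on the second
  value of a variable that the refutation for the first value does not use. Once the edges between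
  the sides are set, either the left side is contradictory by itself, or the search reaches an
  assignment that is consistent on the left and then refutes the right side without using any
  variable of the left one, so that it never returns to the left side. Hence the number of visited
  nodes is at most \<open>2 ^ (m - s + 2)\<close>, where \<open>s\<close> is the smaller number of edges within a side.

  For the partition, distribute the vertices over six blocks of almost equal degree sum, and try
  all ways of merging the blocks into two sides. On average over the ten ways to split the blocks
  three to three, two fifths of the edges stay within a side, and since the degree sums of both
  sides are almost equal, these edges are shared almost equally. So the exponent is \<open>0.8 m\<close> plus a
  multiple of the maximum degree, which is below the claimed exponent, as \<open>1 - 2 (1 - 1 / sqrt 2)\<^sup>2 > 0.82\<close>.\<close>

section \<open>Symbolic execution of programs\<close>

text \<open>Six is the least even number of blocks that works. An even split of 2k blocks puts two
  given blocks on the same side with frequency (k - 1) / (2k - 1), and each side holds about half of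
  these edges. For k = 2 that is m / 6 and gives the exponent 5/6, which exceeds 2 sqrt 2 - 2 =
  0.828..., the closed form of the claimed exponent; for k = 3 it is m / 5. A constant number of
  blocks also makes the choice deterministic, since only 64 assignments of blocks to sides exist.
  Averaging controls only the total number of inner edges, whereas the search pays for the smaller
  side. Balance closes this gap: the degree sum of a side is twice its inner edges plus the crossing
  edges, so equal degree sums force equal numbers of inner edges. The maximum degree D enters twice.
  Blocks may differ by D, which costs 3/4 D in the exponent, and the input may have about 2m * 2^D
  clauses, which a time bound of degree 13 in the input size turns into 13 D. Both fit into the term
  14 D of size o(m).\<close>

definition sem :: "program \<Rightarrow> data list \<Rightarrow> expr \<Rightarrow> (data \<times> nat) option" where
  "sem P r e = (if \<exists>v t. eval P r e v t then Some (THE vt. eval P r e (fst vt) (snd vt)) else None)"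

definition sems :: "program \<Rightarrow> data list \<Rightarrow> expr list \<Rightarrow> (data list \<times> nat) option" where
  "sems P r es = (if \<exists>vs t. evals P r es vs t then Some (THE vt. evals P r es (fst vt) (snd vt)) else None)"

lemma sem_eq_Some_iff: "sem P r e = Some (v, t) \<longleftrightarrow> eval P r e v t"
proof -
  have "(THE vt. eval P r e (fst vt) (snd vt)) = (v', t')" if "eval P r e v' t'" for v' t'
    using that by (intro the_equality) (auto dest: eval_deterministic)
  then show ?thesis
    unfolding sem_def by (auto dest: eval_deterministic)
qed

lemma sems_eq_Some_iff: "sems P r es = Some (vs, t) \<longleftrightarrow> evals P r es vs t"
proof -
  have "(THE vt. evals P r es (fst vt) (snd vt)) = (v', t')" if "evals P r es v' t'" for v' t'
    using that by (intro the_equality) (auto dest: eval_deterministic)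
  then show ?thesis
    unfolding sems_def by (auto dest: eval_deterministic)
qed

lemma sem_eqI:
  assumes "\<And>v t. eval P r e v t \<Longrightarrow> x = Some (v, t)" and "\<And>v t. x = Some (v, t) \<Longrightarrow> eval P r e v t"
  shows "sem P r e = x"
proof (cases x)
  case None
  with assms(1) show ?thesis
    unfolding sem_def by auto
next
  case (Some p)
  with assms(2) show ?thesis
    by (cases p) (simp add: sem_eq_Some_iff)
qed

lemma sems_eqI:
  assumes "\<And>v t. evals P r e v t \<Longrightarrow> x = Some (v, t)" and "\<And>v t. x = Some (v, t) \<Longrightarrow> evals P r e v t"
  shows "sems P r e = x"
proof (cases x)
  case None
  with assms(1) show ?thesis
    unfolding sems_def by auto
next
  case (Some p)
  with assms(2) show ?thesis
    by (cases p) (simp add: sems_eq_Some_iff)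
qed

lemmas eval_intros = eval_evals.intros[unfolded Suc_eq_plus1[symmetric]]

lemmas eval_iff_sem = sem_eq_Some_iff[symmetric] sems_eq_Some_iff[symmetric]

text \<open>Together with the equations that follow, this lets the simplifier run a program body:
  evaluation becomes rewriting of option values, and the value and the step count come out as
  terms.\<close>

lemma sem_Arg: "i < length r \<Longrightarrow> sem P r (Arg i) = Some (r ! i, 1)"
  unfolding sem_eq_Some_iff by (rule eval_Arg)

lemma sem_AtomE: "sem P r AtomE = Some (Atom, 1)"
  unfolding sem_eq_Some_iff by (rule eval_Atom)

lemma sem_NodeE:
  "sem P r (NodeE a b) = (case sem P r a of None \<Rightarrow> None | Some (v1, t1) \<Rightarrow>
     (case sem P r b of None \<Rightarrow> None | Some (v2, t2) \<Rightarrow> Some (Node v1 v2, t1 + t2 + 1)))"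
proof (rule sem_eqI, goal_cases)
  case 1
  then show ?case
    by (elim eval_elims) (simp_all add: eval_iff_sem)
next
  case 2
  then show ?case
    by (auto simp: sem_eq_Some_iff sems_eq_Some_iff split: option.splits prod.splits if_splits intro: eval_intros)
qed

lemma sem_Fst:
  "sem P r (Fst a) = (case sem P r a of None \<Rightarrow> None | Some (v, t) \<Rightarrow> Some (first v, t + 1))"
proof (rule sem_eqI, goal_cases)
  case 1
  then show ?case
    by (elim eval_elims) (simp_all add: eval_iff_sem)
next
  case 2
  then show ?case
    by (auto simp: sem_eq_Some_iff sems_eq_Some_iff split: option.splits prod.splits if_splits intro: eval_intros)
qed

lemma sem_Snd:
  "sem P r (Snd a) = (case sem P r a of None \<Rightarrow> None | Some (v, t) \<Rightarrow> Some (second v, t + 1))"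
proof (rule sem_eqI, goal_cases)
  case 1
  then show ?case
    by (elim eval_elims) (simp_all add: eval_iff_sem)
next
  case 2
  then show ?case
    by (auto simp: sem_eq_Some_iff sems_eq_Some_iff split: option.splits prod.splits if_splits intro: eval_intros)
qed

lemma sem_IfE:
  "sem P r (IfE b e1 e2) = (case sem P r b of None \<Rightarrow> None | Some (u, s) \<Rightarrow>
     (case sem P r (if u = Atom then e2 else e1) of None \<Rightarrow> None | Some (v, t) \<Rightarrow> Some (v, s + t + 1)))"
proof (rule sem_eqI, goal_cases)
  case 1
  then show ?case
    by (elim eval_elims) (simp_all add: eval_iff_sem)
next
  case 2
  then show ?case
    by (auto simp: sem_eq_Some_iff sems_eq_Some_iff split: option.splits prod.splits if_splits intro: eval_intros)
qed

lemma sem_LetE: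
  "sem P r (LetE e1 e2) = (case sem P r e1 of None \<Rightarrow> None | Some (u, s) \<Rightarrow>
     (case sem P (u # r) e2 of None \<Rightarrow> None | Some (v, t) \<Rightarrow> Some (v, s + t + 1)))"
proof (rule sem_eqI, goal_cases)
  case 1
  then show ?case
    by (elim eval_elims) (simp_all add: eval_iff_sem)
next
  case 2
  then show ?case
    by (auto simp: sem_eq_Some_iff sems_eq_Some_iff split: option.splits prod.splits if_splits intro: eval_intros)
qed

lemma sems_Nil: "sems P r [] = Some ([], 0)"
  unfolding sems_eq_Some_iff by (rule evals_Nil)

lemma sems_Cons:
  "sems P r (e # es) = (case sem P r e of None \<Rightarrow> None | Some (v, s) \<Rightarrow>
     (case sems P r es of None \<Rightarrow> None | Some (vs, t) \<Rightarrow> Some (v # vs, s + t)))"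
proof (rule sems_eqI, goal_cases)
  case 1
  then show ?case
    by (elim evals_elims) (simp_all add: eval_iff_sem)
next
  case 2
  then show ?case
    by (auto simp: sem_eq_Some_iff sems_eq_Some_iff split: option.splits prod.splits if_splits intro: eval_intros)
qed

lemma sem_Call:
  "f < length P \<Longrightarrow> sem P r (Call f es) = (case sems P r es of None \<Rightarrow> None | Some (vs, s) \<Rightarrow>
     (case sem P vs (P ! f) of None \<Rightarrow> None | Some (v, t) \<Rightarrow> Some (v, s + t + 1)))"
proof (rule sem_eqI, goal_cases)
  case 1
  then show ?case
    by (elim eval_elims) (simp_all add: eval_iff_sem)
next
  case 2
  then show ?case
    by (auto simp: sem_eq_Some_iff sems_eq_Some_iff split: option.splits prod.splits if_splits intro: eval_intros)
qed


section \<open>The program\<close>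

abbreviation (input) "f_main \<equiv> 0 :: nat"
abbreviation (input) "f_eq \<equiv> 1 :: nat"
abbreviation (input) "f_mem \<equiv> 2 :: nat"
abbreviation (input) "f_sub \<equiv> 3 :: nat"
abbreviation (input) "f_find \<equiv> 4 :: nat"
abbreviation (input) "f_diff \<equiv> 5 :: nat"
abbreviation (input) "f_app \<equiv> 6 :: nat"
abbreviation (input) "f_union \<equiv> 7 :: nat"
abbreviation (input) "f_solve \<equiv> 8 :: nat"
abbreviation (input) "f_vars \<equiv> 9 :: nat"
abbreviation (input) "f_covered \<equiv> 10 :: nat"
abbreviation (input) "f_stars \<equiv> 11 :: nat"
abbreviation (input) "f_unions \<equiv> 12 :: nat"
abbreviation (input) "f_leq \<equiv> 13 :: nat"
abbreviation (input) "f_insort \<equiv> 14 :: nat"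
abbreviation (input) "f_blocks \<equiv> 15 :: nat"
abbreviation (input) "f_cand \<equiv> 16 :: nat"
abbreviation (input) "f_best \<equiv> 17 :: nat"

abbreviation (input) "trueE \<equiv> NodeE AtomE AtomE"

definition main_body :: expr where
  "main_body =
    LetE (Call f_stars [Arg 0])
      (Call f_solve
        [Snd (Call f_best [Call f_blocks [Arg 0], AtomE, AtomE, Call f_unions [Arg 0]]), AtomE, Arg 1])"

definition eq_body :: expr where
  "eq_body =
    IfE (Arg 0)
      (IfE (Arg 1)
        (IfE (Call f_eq [Fst (Arg 0), Fst (Arg 1)]) (Call f_eq [Snd (Arg 0), Snd (Arg 1)]) AtomE)
        AtomE)
      (IfE (Arg 1) AtomE trueE)"

definition mem_body :: expr where
  "mem_body =
    IfE (Arg 1)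
      (IfE (Call f_eq [Arg 0, Fst (Arg 1)]) trueE (Call f_mem [Arg 0, Snd (Arg 1)]))
      AtomE"

definition sub_body :: expr where
  "sub_body =
    IfE (Arg 0)
      (IfE (Call f_mem [Fst (Arg 0), Arg 1]) (Call f_sub [Snd (Arg 0), Arg 1]) AtomE)
      trueE"

definition find_body :: expr where
  "find_body =
    IfE (Arg 0)
      (IfE (Call f_sub [Fst (Arg 0), Arg 1]) (NodeE AtomE (Fst (Arg 0)))
        (Call f_find [Snd (Arg 0), Arg 1]))
      AtomE"

definition diff_body :: expr where
  "diff_body =
    IfE (Arg 0)
      (IfE (Call f_mem [Fst (Arg 0), Arg 1]) (Call f_diff [Snd (Arg 0), Arg 1])
        (NodeE (Fst (Arg 0)) (Call f_diff [Snd (Arg 0), Arg 1])))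
      AtomE"

definition app_body :: expr where
  "app_body =
    IfE (Arg 0) (NodeE (Fst (Arg 0)) (Call f_app [Snd (Arg 0), Arg 1])) (Arg 1)"

definition union_body :: expr where
  "union_body =
    Call f_app [Call f_diff [Arg 0, Arg 1], Arg 1]"

text \<open>Intermediate results need no conversion. \<open>f_find\<close> answers with
  \<open>Node Atom c\<close>, which is already the encoded leaf \<open>Initial c\<close>;
  \<open>trueE\<close> is the tag of a positive literal and, in the last line, the encoded
  \<open>Initial []\<close>; and \<open>Snd\<close> of any encoded proof is its conclusion.\<close>

definition solve_body :: expr where
  "solve_body =
    LetE (Call f_find [Arg 2, Arg 1])
      (IfE (Arg 0) (Arg 0)
        (IfE (Arg 1)
          (LetE (NodeE trueE (Fst (Arg 1)))
            (LetE (Call f_solve [Snd (Arg 2), NodeE (Arg 0) (Arg 3), Arg 4])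
              (IfE (Call f_mem [Arg 1, Snd (Arg 0)])
                (LetE (NodeE AtomE (Fst (Arg 3)))
                  (LetE (Call f_solve [Snd (Arg 4), NodeE (Arg 0) (Arg 5), Arg 6])
                    (IfE (Call f_mem [Arg 1, Snd (Arg 0)])
                      (NodeE (NodeE (Arg 2) (Arg 0))
                        (Call f_union
                          [Call f_diff [Snd (Arg 2), NodeE (Arg 3) AtomE],
                           Call f_diff [Snd (Arg 0), NodeE (Arg 1) AtomE]]))
                      (Arg 0))))
                (Arg 0))))
          trueE))"

definition vars_body :: expr where
  "vars_body =
    IfE (Arg 0) (NodeE (Snd (Fst (Arg 0))) (Call f_vars [Snd (Arg 0)])) AtomE"

definition covered_body :: expr where
  "covered_body =
    IfE (Arg 1)
      (IfE (Call f_sub [Arg 0, Fst (Arg 1)]) trueE (Call f_covered [Arg 0, Snd (Arg 1)]))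
      AtomE"

definition stars_body :: expr where
  "stars_body =
    IfE (Arg 0)
      (LetE (Call f_vars [Fst (Arg 0)])
        (LetE (Call f_stars [Snd (Arg 1)])
          (IfE (Call f_covered [Arg 1, Arg 0]) (Arg 0) (NodeE (Arg 1) (Arg 0)))))
      AtomE"

definition unions_body :: expr where
  "unions_body =
    IfE (Arg 0) (Call f_union [Fst (Arg 0), Call f_unions [Snd (Arg 0)]]) AtomE"

definition leq_body :: expr where
  "leq_body =
    IfE (Arg 0) (IfE (Arg 1) (Call f_leq [Snd (Arg 0), Snd (Arg 1)]) AtomE) trueE"

definition insort_body :: expr where
  "insort_body =
    IfE (Arg 1)
      (IfE (Call f_leq [Arg 0, Fst (Arg 1)]) (NodeE (Arg 0) (Arg 1))
        (NodeE (Fst (Arg 1)) (Call f_insort [Arg 0, Snd (Arg 1)])))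
      (NodeE (Arg 0) AtomE)"

definition blocks_body :: expr where
  "blocks_body =
    IfE (Arg 0)
      (LetE (Call f_blocks [Snd (Arg 0)])
        (Call f_insort [Call f_app [Fst (Arg 1), Fst (Arg 0)], Snd (Arg 0)]))
      (NodeE AtomE (NodeE AtomE (NodeE AtomE (NodeE AtomE (NodeE AtomE (NodeE AtomE AtomE))))))"

definition cand_body :: expr where
  "cand_body =
    LetE (Call f_diff [Arg 0, Arg 2])
      (LetE (Call f_diff [Arg 1, Arg 2])
        (NodeE (IfE (Call f_leq [Arg 1, Arg 0]) (Arg 1) (Arg 0))
          (Call f_app [Call f_diff [Call f_diff [Arg 2, Arg 1], Arg 0], Call f_app [Arg 1, Arg 0]])))"

definition best_body :: expr where
  "best_body =
    IfE (Arg 0)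
      (LetE (Call f_best [Snd (Arg 0), Call f_app [Fst (Arg 0), Arg 1], Arg 2, Arg 3])
        (LetE (Call f_best [Snd (Arg 1), Arg 2, Call f_app [Fst (Arg 1), Arg 3], Arg 4])
          (IfE (Call f_leq [Fst (Arg 0), Fst (Arg 1)]) (Arg 1) (Arg 0))))
      (Call f_cand [Arg 3, Arg 1, Arg 2])"

definition prog :: program where
  "prog =
    [main_body, eq_body, mem_body, sub_body, find_body,
     diff_body, app_body, union_body, solve_body, vars_body,
     covered_body, stars_body, unions_body, leq_body, insort_body,
     blocks_body, cand_body, best_body]"

definition call :: "nat \<Rightarrow> data list \<Rightarrow> (data \<times> nat) option" where
  "call f vs = sem prog vs (prog ! f)"

lemma call_unfold:
  "call f_main vs = sem prog vs main_body"
  "call (Suc 0) vs = sem prog vs eq_body"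
  "call f_mem vs = sem prog vs mem_body"
  "call f_sub vs = sem prog vs sub_body"
  "call f_find vs = sem prog vs find_body"
  "call f_diff vs = sem prog vs diff_body"
  "call f_app vs = sem prog vs app_body"
  "call f_union vs = sem prog vs union_body"
  "call f_solve vs = sem prog vs solve_body"
  "call f_vars vs = sem prog vs vars_body"
  "call f_covered vs = sem prog vs covered_body"
  "call f_stars vs = sem prog vs stars_body"
  "call f_unions vs = sem prog vs unions_body"
  "call f_leq vs = sem prog vs leq_body"
  "call f_insort vs = sem prog vs insort_body"
  "call f_blocks vs = sem prog vs blocks_body"
  "call f_cand vs = sem prog vs cand_body"
  "call f_best vs = sem prog vs best_body"
  unfolding call_def by (simp_all add: prog_def)

lemma sem_prog_Call:
  "f < 18 \<Longrightarrow> sem prog r (Call f es) = (case sems prog r es of None \<Rightarrow> None | Some (vs, s) \<Rightarrow>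
     (case call f vs of None \<Rightarrow> None | Some (v, t) \<Rightarrow> Some (v, s + t + 1)))"
  unfolding call_def by (rule sem_Call) (simp add: prog_def)

lemmas sem_simps = sem_Arg sem_AtomE sem_NodeE sem_Fst sem_Snd sem_IfE sem_LetE
  sems_Nil sems_Cons sem_prog_Call

text \<open>Values are exact while times are only bounded, so that costs can be rounded up to powers
  of \<open>N\<close>.\<close>

definition runs :: "nat \<Rightarrow> data list \<Rightarrow> data \<Rightarrow> nat \<Rightarrow> bool" where
  "runs f vs v T \<longleftrightarrow> (\<exists>t\<le>T. call f vs = Some (v, t))"

lemma runsE:
  assumes "runs f vs v T"
  obtains t where "call f vs = Some (v, t)" "t \<le> T"
  using assms unfolding runs_def by blast

lemma runs_mono: "runs f vs v T \<Longrightarrow> T \<le> T' \<Longrightarrow> runs f vs v T'"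
  unfolding runs_def by (meson le_trans)

definition tt :: "bool \<Rightarrow> data" where
  "tt b = (if b then Node Atom Atom else Atom)"

lemma tt_simps [simp]: "tt True = Node Atom Atom" "tt False = Atom"
  "tt b = Atom \<longleftrightarrow> \<not> b"
  by (simp_all add: tt_def)

section \<open>Costs of the functions of the program\<close>

text \<open>\<open>2 * size a + 1\<close> counts all constructors of \<open>a\<close>, atoms
  included, and each of them costs at most 16 steps. The recursion ends when \<open>a\<close> is
  exhausted, so \<open>b\<close> does not enter the bound.\<close>

lemma runs_eq: "runs f_eq [a, b] (tt (a = b)) (16 * (2 * size a + 1))"
proof (induction a arbitrary: b)
  case Atom
  show ?case
    by (cases b) (simp_all add: runs_def call_unfold eq_body_def sem_simps)
next
  case (Node a1 a2)
  show ?case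
  proof (cases b)
    case Atom
    then show ?thesis
      by (simp add: runs_def call_unfold eq_body_def sem_simps)
  next
    case b: (Node b1 b2)
    obtain t1 where "call f_eq [a1, b1] = Some (tt (a1 = b1), t1)" "t1 \<le> 16 * (2 * size a1 + 1)"
      using Node.IH(1) by (rule runsE)
    moreover obtain t2 where "call f_eq [a2, b2] = Some (tt (a2 = b2), t2)" "t2 \<le> 16 * (2 * size a2 + 1)"
      using Node.IH(2) by (rule runsE)
    moreover have "call f_eq [Node a1 a2, b] = sem prog [Node a1 a2, b] eq_body"
      using call_unfold(2) by simp
    ultimately show ?thesis
      by (cases "a1 = b1") (simp_all add: runs_def b eq_body_def sem_simps)
  qed
qed

lemma enc_list_eq_Atom [simp]: "enc_list f xs = Atom \<longleftrightarrow> xs = []"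
  by (cases xs) auto

lemma first_enc_list [simp]: "xs \<noteq> [] \<Longrightarrow> first (enc_list f xs) = f (hd xs)"
  by (cases xs) auto

lemma second_enc_list [simp]: "second (enc_list f xs) = enc_list f (tl xs)"
  by (cases xs) auto

lemma runs_app: "runs f_app [enc_list f xs, enc_list f ys] (enc_list f (xs @ ys)) (20 * (length xs + 1))"
proof (induction xs)
  case Nil
  show ?case
    by (simp add: runs_def call_unfold app_body_def sem_simps)
next
  case (Cons x xs)
  from Cons.IH obtain t where "call f_app [enc_list f xs, enc_list f ys] = Some (enc_list f (xs @ ys), t)"
    "t \<le> 20 * (length xs + 1)" by (rule runsE)
  then show ?case
    \<comment> \<open>The pattern \<open>Node _ _\<close> matches only the outer call, so the
      recursive call stays folded and is rewritten by the induction hypothesis. The same device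
      recurs below.\<close>
    by (simp add: runs_def call_unfold(7)[of "[Node _ _, _]"] app_body_def sem_simps)
qed

lemma runs_leq: "runs f_leq [enc_list f xs, enc_list g ys] (tt (length xs \<le> length ys)) (20 * (length xs + 1))"
proof (induction xs arbitrary: ys)
  case Nil
  show ?case
    by (simp add: runs_def call_unfold leq_body_def sem_simps)
next
  case (Cons x xs)
  show ?case
  proof (cases ys)
    case Nil
    then show ?thesis
      by (simp add: runs_def call_unfold leq_body_def sem_simps)
  next
    case ys: (Cons y ys')
    from Cons.IH obtain t where "call f_leq [enc_list f xs, enc_list g ys'] = Some (tt (length xs \<le> length ys'), t)"
      "t \<le> 20 * (length xs + 1)" by (rule runsE)
    then show ?thesis
      by (simp add: ys runs_def call_unfold(14)[of "[Node _ _, _]"] leq_body_def sem_simps)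
  qed
qed


text \<open>All costs are bounded by powers of a common bound \<open>N\<close> for lengths and sizes; \<open>64 \<le> N\<close> absorbs
  the constants.\<close>

lemma bound_step:
  fixes N :: nat
  assumes "64 \<le> N" "b \<le> N ^ j" "l \<le> N"
  shows "(b + 20) * (l + 1) \<le> N ^ (j + 2)"
proof -
  have "1 \<le> N ^ j"
    using assms(1) by simp
  then have "b + 20 \<le> 21 * N ^ j"
    using assms(2) by linarith
  moreover have "l + 1 \<le> 2 * N"
    using assms by linarith
  ultimately have "(b + 20) * (l + 1) \<le> (21 * N ^ j) * (2 * N)"
    by (rule mult_le_mono)
  also have "\<dots> = 42 * (N ^ j * N)"
    by simp
  also have "\<dots> \<le> N * (N ^ j * N)"
    using assms(1) by (intro mult_right_mono) auto
  finally show ?thesis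
    by (simp add: ac_simps power_add power2_eq_square)
qed

lemma bound_sum:
  fixes N :: nat
  assumes "64 \<le> N" "i \<le> j"
  shows "N ^ i \<le> N ^ j" "64 * N ^ j \<le> N ^ Suc j" "1 \<le> N ^ j"
  using assms by (auto intro: power_increasing)

section \<open>Functional models of the partitioning routines\<close>

definition union :: "'a list \<Rightarrow> 'a list \<Rightarrow> 'a list" where
  "union xs ys = filter (\<lambda>x. x \<notin> set ys) xs @ ys"

lemma set_union [simp]: "set (union xs ys) = set xs \<union> set ys"
  by (auto simp: union_def)

text \<open>Vertices are recovered from a formula as the variable sets of its clauses. Keeping only sets not
  covered by others merges the clauses of a vertex, whatever the order of their literals.\<close>

fun stars :: "'a list list \<Rightarrow> 'a list list" where
  "stars [] = []"
| "stars (I # Is) =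
    (let Ks = stars Is in if \<exists>K\<in>set Ks. set I \<subseteq> set K then Ks else I # Ks)"

definition unions :: "'a list list \<Rightarrow> 'a list" where
  "unions Ks = foldr union Ks []"

text \<open>Greedy load balancing: the list is kept sorted by length, so its head is a smallest
  block and receives the next star. Duplicates are kept, so the length of a block is a degree
  sum.\<close>

definition blocks :: "'a list list \<Rightarrow> 'a list list" where
  "blocks Ks = foldr (\<lambda>K bs. insort_key length (K @ hd bs) (tl bs)) Ks (replicate 6 [])"

text \<open>\<open>A\<close> and \<open>B\<close> concatenate the stars of the two sides.
  \<open>a\<close> and \<open>b\<close> are the edges that the other side does not meet; the
  remaining ones cross. The first component serves as a score in unary, of which only the length
  matters; the second is the branching order.\<close>

definition cand :: "'a list \<Rightarrow> 'a list \<Rightarrow> 'a list \<Rightarrow> 'a list \<times> 'a list" where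
  "cand U A B =
    (let a = filter (\<lambda>x. x \<notin> set B) U; b = filter (\<lambda>x. x \<notin> set A) U in
      (if length a \<le> length b then a else b,
       filter (\<lambda>x. x \<notin> set b) (filter (\<lambda>x. x \<notin> set a) U) @ a @ b))"

text \<open>All assignments of blocks to sides compete, balanced or not. The analysis exhibits one
  good even split, and the winner scores at least as well.\<close>

fun best :: "'a list list \<Rightarrow> 'a list \<Rightarrow> 'a list \<Rightarrow> 'a list \<Rightarrow> 'a list \<times> 'a list" where
  "best [] A B U = cand U A B"
| "best (b # bs) A B U =
    (let r1 = best bs (b @ A) B U; r2 = best bs A (b @ B) U in
      if length (fst r2) \<le> length (fst r1) then r1 else r2)"

lemma set_unions: "set (unions Ks) = \<Union> (set ` set Ks)"
  by (induction Ks) (auto simp: unions_def)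

lemma length_unions: "length (unions Ks) \<le> length (concat Ks)"
proof (induction Ks)
  case (Cons K Ks)
  have "length (filter (\<lambda>x. x \<notin> set (unions Ks)) K) \<le> length K"
    by simp
  with Cons show ?case
    by (simp add: unions_def union_def add_mono)
qed (simp add: unions_def)

lemma mset_concat_insort_key: "mset (concat (insort_key f b bs)) = mset b + mset (concat bs)"
  by (induction bs) auto

lemma length_insort_key [simp]: "length (insort_key f b bs) = Suc (length bs)"
  by (induction bs) auto

lemma blocks_Nil: "blocks [] = [[], [], [], [], [], []]"
  by (simp add: blocks_def numeral_eq_Suc)

lemma length_blocks [simp]: "length (blocks Ks) = 6"
  by (induction Ks) (auto simp: blocks_def)

lemma blocks_Cons: "blocks (K # Ks) = insort_key length (K @ hd (blocks Ks)) (tl (blocks Ks))"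
  by (simp add: blocks_def)

lemma blocks_not_Nil [simp]: "blocks Ks \<noteq> []"
  using length_blocks[of Ks] by fastforce

lemma mset_concat_blocks: "mset (concat (blocks Ks)) = mset (concat Ks)"
proof (induction Ks)
  case (Cons K Ks)
  have "mset (concat (blocks Ks)) = mset (hd (blocks Ks)) + mset (concat (tl (blocks Ks)))"
    by (cases "blocks Ks") (auto dest: arg_cong[of "blocks Ks" "[]" length])
  with Cons show ?case
    by (simp add: blocks_Cons mset_concat_insort_key)
qed (simp add: blocks_def numeral_eq_Suc)

text \<open>The same program functions serve lists of variables and lists of literals, so costs are
  proved once for any injective encoding. Injectivity turns equality of trees into equality of
  elements.\<close>

locale bounded_encoding =
  fixes enc :: "'a \<Rightarrow> data" and N :: nat
  assumes inj_enc: "inj enc" and N: "64 \<le> N"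
begin

abbreviation L :: "'a list \<Rightarrow> data" where
  "L \<equiv> enc_list enc"

abbreviation LL :: "'a list list \<Rightarrow> data" where
  "LL \<equiv> enc_list L"

definition bounded :: "'a set \<Rightarrow> bool" where
  "bounded X \<longleftrightarrow> (\<forall>x\<in>X. size (enc x) \<le> N)"

lemma bounded_simps [simp]: "bounded {}" "bounded (insert x X) \<longleftrightarrow> size (enc x) \<le> N \<and> bounded X"
  "bounded (X \<union> Y) \<longleftrightarrow> bounded X \<and> bounded Y"
  by (auto simp: bounded_def)

lemma bounded_mono: "bounded Y \<Longrightarrow> X \<subseteq> Y \<Longrightarrow> bounded X"
  by (auto simp: bounded_def)

lemma runs_eq_enc:
  assumes "size (enc x) \<le> N"
  shows "runs f_eq [enc x, enc y] (tt (x = y)) (N ^ 2)"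
proof -
  have "16 * (2 * size (enc x) + 1) \<le> 16 * (3 * N)"
    using assms N by simp
  also have "\<dots> \<le> N * N"
    using N by simp
  finally show ?thesis
    using runs_mono[OF runs_eq[of "enc x" "enc y"]] inj_enc
    by (simp add: power2_eq_square inj_eq)
qed

lemma runs_mem':
  assumes "size (enc x) \<le> N"
  shows "runs f_mem [enc x, L xs] (tt (x \<in> set xs)) ((N ^ 2 + 20) * (length xs + 1))"
proof (induction xs)
  case Nil
  show ?case
    by (simp add: runs_def call_unfold mem_body_def sem_simps)
next
  case (Cons y ys)
  obtain s where "call f_eq [enc x, enc y] = Some (tt (x = y), s)" "s \<le> N ^ 2"
    using runs_eq_enc[OF assms] by (rule runsE)
  moreover obtain t where "call f_mem [enc x, L ys] = Some (tt (x \<in> set ys), t)"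
    "t \<le> (N ^ 2 + 20) * (length ys + 1)"
    using Cons.IH by (rule runsE)
  ultimately show ?case
    by (cases "x = y") (simp_all add: runs_def call_unfold(3)[of "[_, Node _ _]"] mem_body_def sem_simps)
qed

lemma runs_mem:
  assumes "size (enc x) \<le> N" "length xs \<le> N"
  shows "runs f_mem [enc x, L xs] (tt (x \<in> set xs)) (N ^ 4)"
  using runs_mono[OF runs_mem' bound_step[of N "N ^ 2" 2]] assms N by simp

lemma runs_sub':
  assumes "bounded (set xs)" "length ys \<le> N"
  shows "runs f_sub [L xs, L ys] (tt (set xs \<subseteq> set ys)) ((N ^ 4 + 20) * (length xs + 1))"
  using assms(1)
proof (induction xs)
  case Nil
  show ?case
    by (simp add: runs_def call_unfold sub_body_def sem_simps)
next
  case (Cons x xs)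
  obtain s where "call f_mem [enc x, L ys] = Some (tt (x \<in> set ys), s)" "s \<le> N ^ 4"
    using runs_mem[of x ys] Cons.prems assms(2) by (auto elim: runsE)
  moreover obtain t where "call f_sub [L xs, L ys] = Some (tt (set xs \<subseteq> set ys), t)"
    "t \<le> (N ^ 4 + 20) * (length xs + 1)"
    using Cons by (auto elim: runsE)
  ultimately show ?case
    by (cases "x \<in> set ys")
      (simp_all add: runs_def call_unfold(4)[of "[Node _ _, _]"] sub_body_def sem_simps)
qed

lemma runs_sub:
  assumes "bounded (set xs)" "length xs \<le> N" "length ys \<le> N"
  shows "runs f_sub [L xs, L ys] (tt (set xs \<subseteq> set ys)) (N ^ 6)"
  using runs_mono[OF runs_sub' bound_step[of N "N ^ 4" 4]] assms N by simp

lemma runs_find':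
  assumes "\<forall>c\<in>set cs. bounded (set c) \<and> length c \<le> N" "length ys \<le> N"
  shows "runs f_find [LL cs, L ys]
    (case find (\<lambda>c. set c \<subseteq> set ys) cs of None \<Rightarrow> Atom | Some c \<Rightarrow> Node Atom (L c))
    ((N ^ 6 + 20) * (length cs + 1))"
  using assms(1)
proof (induction cs)
  case Nil
  show ?case
    by (simp add: runs_def call_unfold find_body_def sem_simps)
next
  case (Cons c cs)
  obtain s where "call f_sub [L c, L ys] = Some (tt (set c \<subseteq> set ys), s)" "s \<le> N ^ 6"
    using runs_sub[of c ys] Cons.prems assms(2) by (auto elim: runsE)
  moreover obtain t where "call f_find [LL cs, L ys] =
      Some (case find (\<lambda>c. set c \<subseteq> set ys) cs of None \<Rightarrow> Atom | Some c \<Rightarrow> Node Atom (L c), t)"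
    "t \<le> (N ^ 6 + 20) * (length cs + 1)"
    using Cons by (auto elim: runsE)
  ultimately show ?case
    by (cases "set c \<subseteq> set ys")
      (simp_all add: runs_def call_unfold(5)[of "[Node _ _, _]"] find_body_def sem_simps)
qed

lemma runs_find:
  assumes "\<forall>c\<in>set cs. bounded (set c) \<and> length c \<le> N" "length ys \<le> N" "length cs \<le> N"
  shows "runs f_find [LL cs, L ys]
    (case find (\<lambda>c. set c \<subseteq> set ys) cs of None \<Rightarrow> Atom | Some c \<Rightarrow> Node Atom (L c)) (N ^ 8)"
  using runs_mono[OF runs_find'[of cs ys] bound_step[of N "N ^ 6" 6]] assms N by simp

lemma runs_diff':
  assumes "bounded (set xs)" "length ys \<le> N"
  shows "runs f_diff [L xs, L ys] (L (filter (\<lambda>x. x \<notin> set ys) xs)) ((N ^ 4 + 20) * (length xs + 1))"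
  using assms(1)
proof (induction xs)
  case Nil
  show ?case
    by (simp add: runs_def call_unfold diff_body_def sem_simps)
next
  case (Cons x xs)
  obtain s where "call f_mem [enc x, L ys] = Some (tt (x \<in> set ys), s)" "s \<le> N ^ 4"
    using runs_mem[of x ys] Cons.prems assms(2) by (auto elim: runsE)
  moreover obtain t where "call f_diff [L xs, L ys] = Some (L (filter (\<lambda>x. x \<notin> set ys) xs), t)"
    "t \<le> (N ^ 4 + 20) * (length xs + 1)"
    using Cons by (auto elim: runsE)
  ultimately show ?case
    by (cases "x \<in> set ys")
      (simp_all add: runs_def call_unfold(6)[of "[Node _ _, _]"] diff_body_def sem_simps)
qed

lemma runs_diff:
  assumes "bounded (set xs)" "length xs \<le> N" "length ys \<le> N"
  shows "runs f_diff [L xs, L ys] (L (filter (\<lambda>x. x \<notin> set ys) xs)) (N ^ 6)"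
  using runs_mono[OF runs_diff' bound_step[of N "N ^ 4" 4]] assms N by simp

lemma runs_app_bounded:
  "length xs \<le> N \<Longrightarrow> runs f_app [enc_list f xs, enc_list f ys] (enc_list f (xs @ ys)) (N ^ 2)"
  using bound_step[OF N, of 0 0 "length xs"] by (intro runs_mono[OF runs_app]) (simp add: power2_eq_square)

lemma runs_leq_bounded:
  "length xs \<le> N \<Longrightarrow> runs f_leq [enc_list f xs, enc_list g ys] (tt (length xs \<le> length ys)) (N ^ 2)"
  using bound_step[OF N, of 0 0 "length xs"] by (intro runs_mono[OF runs_leq]) (simp add: power2_eq_square)

text \<open>Lets linear arithmetic, which sees each power of \<open>N\<close> as an atom, absorb 64
  copies of a cost into the next power.\<close>

lemma N_powers:
  "N ^ 2 \<le> N ^ 6" "1 \<le> N ^ 6" "64 * N ^ 6 \<le> N ^ 7" "64 * N ^ 7 \<le> N ^ 8" "64 * N ^ 8 \<le> N ^ 9"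
  "64 * N ^ 2 \<le> N ^ 3" "64 * N ^ 3 \<le> N ^ 4" "64 * N ^ 4 \<le> N ^ 5" "64 * N ^ 5 \<le> N ^ 6"
  "64 * N ^ 9 \<le> N ^ 10" "64 * N ^ 10 \<le> N ^ 11" "64 * N ^ 11 \<le> N ^ 12" "64 \<le> N ^ 2"
  using order.trans[OF N self_le_power[of N 2]] N bound_sum[OF N, of 2 6] bound_sum[OF N, of 0 6] bound_sum[OF N, of 1 1]
    bound_sum(2)[OF N le_refl, of 6] bound_sum(2)[OF N le_refl, of 7] bound_sum(2)[OF N le_refl, of 8]
    bound_sum(2)[OF N le_refl, of 2] bound_sum(2)[OF N le_refl, of 3] bound_sum(2)[OF N le_refl, of 4]
    bound_sum(2)[OF N le_refl, of 5] bound_sum(2)[OF N le_refl, of 9]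
    bound_sum(2)[OF N le_refl, of 10] bound_sum(2)[OF N le_refl, of 11]
  by simp_all

lemma runs_union:
  assumes "bounded (set xs)" "length xs \<le> N" "length ys \<le> N"
  shows "runs f_union [L xs, L ys] (L (union xs ys)) (N ^ 7)"
proof -
  obtain s where "call f_diff [L xs, L ys] = Some (L (filter (\<lambda>x. x \<notin> set ys) xs), s)" "s \<le> N ^ 6"
    using runs_diff[OF assms] by (rule runsE)
  moreover have "length (filter (\<lambda>x. x \<notin> set ys) xs) \<le> N"
    using assms(2) by (meson le_trans length_filter_le)
  then obtain t where "call f_app [L (filter (\<lambda>x. x \<notin> set ys) xs), L ys] =
      Some (L (filter (\<lambda>x. x \<notin> set ys) xs @ ys), t)" "t \<le> N ^ 2"
    by (rule runsE[OF runs_app_bounded])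
  ultimately show ?thesis
    using N_powers by (simp add: runs_def call_unfold union_body_def sem_simps union_def)
qed

lemma runs_covered':
  assumes "bounded (set xs)" "length xs \<le> N" "\<forall>K\<in>set Ks. length K \<le> N"
  shows "runs f_covered [L xs, LL Ks] (tt (\<exists>K\<in>set Ks. set xs \<subseteq> set K)) ((N ^ 6 + 20) * (length Ks + 1))"
  using assms(3)
proof (induction Ks)
  case Nil
  show ?case
    by (simp add: runs_def call_unfold covered_body_def sem_simps)
next
  case (Cons K Ks)
  obtain s where "call f_sub [L xs, L K] = Some (tt (set xs \<subseteq> set K), s)" "s \<le> N ^ 6"
    using runs_sub[of xs K] Cons.prems assms(1,2) by (auto elim: runsE)
  moreover obtain t where "call f_covered [L xs, LL Ks] = Some (tt (\<exists>K\<in>set Ks. set xs \<subseteq> set K), t)"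
    "t \<le> (N ^ 6 + 20) * (length Ks + 1)"
    using Cons by (auto elim: runsE)
  ultimately show ?case
    by (cases "set xs \<subseteq> set K")
      (simp_all add: runs_def call_unfold(11)[of "[_, Node _ _]"] covered_body_def sem_simps)
qed

lemma runs_covered:
  assumes "bounded (set xs)" "length xs \<le> N" "\<forall>K\<in>set Ks. length K \<le> N" "length Ks \<le> N"
  shows "runs f_covered [L xs, LL Ks] (tt (\<exists>K\<in>set Ks. set xs \<subseteq> set K)) (N ^ 8)"
  using runs_mono[OF runs_covered'[of xs Ks] bound_step[of N "N ^ 6" 6]] assms N by simp

lemma runs_unions':
  assumes "bounded (set (concat Ks))" "length (concat Ks) \<le> N"
  shows "runs f_unions [LL Ks] (L (unions Ks)) ((N ^ 7 + 20) * (length Ks + 1))"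
  using assms
proof (induction Ks)
  case Nil
  show ?case
    by (simp add: runs_def call_unfold unions_body_def sem_simps unions_def)
next
  case (Cons K Ks)
  have "length (unions Ks) \<le> N"
    using length_unions[of Ks] Cons.prems by simp
  then obtain s where "call f_union [L K, L (unions Ks)] = Some (L (union K (unions Ks)), s)" "s \<le> N ^ 7"
    using runs_union[of K "unions Ks"] Cons.prems by (auto elim: runsE)
  moreover obtain t where "call f_unions [LL Ks] = Some (L (unions Ks), t)"
    "t \<le> (N ^ 7 + 20) * (length Ks + 1)"
    using Cons by (auto elim: runsE)
  ultimately show ?case
    by (simp add: runs_def call_unfold(13)[of "[Node _ _]"] unions_body_def sem_simps unions_def)
qed

lemma runs_unions:
  assumes "bounded (set (concat Ks))" "length (concat Ks) \<le> N" "length Ks \<le> N"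
  shows "runs f_unions [LL Ks] (L (unions Ks)) (N ^ 9)"
  using runs_mono[OF runs_unions'[of Ks] bound_step[of N "N ^ 7" 7]] assms N by simp

lemma runs_insort:
  assumes "length b \<le> N"
  shows "runs f_insort [L b, LL bs] (LL (insort_key length b bs)) ((N ^ 2 + 20) * (length bs + 1))"
proof (induction bs)
  case Nil
  show ?case
    by (simp add: runs_def call_unfold insort_body_def sem_simps)
next
  case (Cons b' bs)
  obtain s where "call f_leq [L b, L b'] = Some (tt (length b \<le> length b'), s)" "s \<le> N ^ 2"
    using runs_leq_bounded[OF assms] by (rule runsE)
  moreover obtain t where "call f_insort [L b, LL bs] = Some (LL (insort_key length b bs), t)"
    "t \<le> (N ^ 2 + 20) * (length bs + 1)"
    using Cons.IH by (rule runsE)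
  ultimately show ?case
    by (cases "length b \<le> length b'")
      (simp_all add: runs_def call_unfold(15)[of "[_, Node _ _]"] insort_body_def sem_simps)
qed

lemma length_hd_blocks: "length (hd (blocks Ks)) \<le> length (concat Ks)"
proof -
  have "length (concat Ks) = length (concat (blocks Ks))"
    using mset_concat_blocks by (metis size_mset)
  then show ?thesis
    by (cases "blocks Ks") (auto dest: arg_cong[of "blocks Ks" "[]" length])
qed

lemma runs_blocks':
  assumes "length (concat Ks) \<le> N"
  shows "runs f_blocks [LL Ks] (LL (blocks Ks)) ((N ^ 4 + 20) * (length Ks + 1))"
  using assms
proof (induction Ks)
  case Nil
  show ?case
    by (simp add: runs_def call_unfold blocks_body_def sem_simps blocks_Nil)
next
  case (Cons K Ks)
  let ?bs = "blocks Ks"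
  have len: "length (K @ hd ?bs) \<le> N" "length K \<le> N"
    using length_hd_blocks[of Ks] Cons.prems by auto
  obtain s where "call f_app [L K, L (hd ?bs)] = Some (L (K @ hd ?bs), s)" "s \<le> N ^ 2"
    using runs_app_bounded[OF len(2)] by (rule runsE)
  moreover obtain u where "call f_insort [L (K @ hd ?bs), LL (tl ?bs)] =
      Some (LL (insort_key length (K @ hd ?bs) (tl ?bs)), u)" "u \<le> (N ^ 2 + 20) * 6"
    using runs_insort[OF len(1), of "tl ?bs"] by (auto elim: runsE)
  moreover obtain t where "call f_blocks [LL Ks] = Some (LL ?bs, t)"
    "t \<le> (N ^ 4 + 20) * (length Ks + 1)"
    using Cons by (auto elim: runsE)
  ultimately show ?case
    using N_powers by (simp add: runs_def call_unfold(16)[of "[Node _ _]"] blocks_body_def sem_simps blocks_Cons)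
qed

lemma runs_blocks:
  assumes "length (concat Ks) \<le> N" "length Ks \<le> N"
  shows "runs f_blocks [LL Ks] (LL (blocks Ks)) (N ^ 6)"
  using runs_mono[OF runs_blocks'[of Ks] bound_step[of N "N ^ 4" 4]] assms N by simp

fun enc_cand :: "'a list \<times> 'a list \<Rightarrow> data" where
  "enc_cand (s, xs) = Node (L s) (L xs)"

lemma runs_cand:
  assumes "bounded (set U)" "length U \<le> N" "length A \<le> N" "length B \<le> N"
  shows "runs f_cand [L U, L A, L B] (enc_cand (cand U A B)) (N ^ 7)"
proof -
  define a where "a = filter (\<lambda>x. x \<notin> set B) U"
  define b where "b = filter (\<lambda>x. x \<notin> set A) U"
  define c where "c = filter (\<lambda>x. x \<notin> set a) U"
  define d where "d = filter (\<lambda>x. x \<notin> set b) c"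
  have len: "length a \<le> N" "length b \<le> N" "length c \<le> N" "length d \<le> N"
    using assms(2) unfolding a_def b_def c_def d_def by (meson le_trans length_filter_le)+
  have c: "bounded (set c)"
    using assms(1) by (rule bounded_mono) (auto simp: c_def)
  obtain t1 where "call f_diff [L U, L B] = Some (L a, t1)" "t1 \<le> N ^ 6"
    using runs_diff[of U B] assms by (auto elim: runsE simp: a_def)
  moreover obtain t2 where "call f_diff [L U, L A] = Some (L b, t2)" "t2 \<le> N ^ 6"
    using runs_diff[of U A] assms by (auto elim: runsE simp: b_def)
  moreover obtain t3 where "call f_diff [L U, L a] = Some (L c, t3)" "t3 \<le> N ^ 6"
    using runs_diff[of U a] assms len by (auto elim: runsE simp: c_def)
  moreover obtain t4 where "call f_diff [L c, L b] = Some (L d, t4)" "t4 \<le> N ^ 6"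
    using runs_diff[of c b] c len by (auto elim: runsE simp: d_def)
  moreover obtain t5 where "call f_leq [L a, L b] = Some (tt (length a \<le> length b), t5)" "t5 \<le> N ^ 2"
    using runs_leq_bounded[OF len(1)] by (rule runsE)
  moreover obtain t6 where "call f_app [L a, L b] = Some (L (a @ b), t6)" "t6 \<le> N ^ 2"
    using runs_app_bounded[OF len(1)] by (rule runsE)
  moreover obtain t7 where "call f_app [L d, L (a @ b)] = Some (L (d @ a @ b), t7)" "t7 \<le> N ^ 2"
    using runs_app_bounded[OF len(4)] by (rule runsE)
  moreover have "cand U A B = (if length a \<le> length b then a else b, d @ a @ b)"
    unfolding cand_def a_def b_def c_def d_def by (simp add: Let_def)
  ultimately show ?thesis
    using N_powers by (cases "length a \<le> length b")
      (simp_all add: runs_def call_unfold cand_body_def sem_simps)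
qed

text \<open>The recursion tree has \<open>2 ^ (length bs + 1) - 1\<close> nodes, and
  \<open>N ^ 8\<close> pays for the work at one of them. The length bound is carried along because
  \<open>f_leq\<close> compares the scores one level up.\<close>

lemma runs_best':
  assumes "bounded (set U)" "length U \<le> N" "length (concat bs) + length A + length B \<le> N"
  shows "runs f_best [LL bs, L A, L B, L U] (enc_cand (best bs A B U)) ((2 ^ (length bs + 1) - 1) * N ^ 8) \<and>
    length (fst (best bs A B U)) \<le> N"
  using assms(3)
proof (induction bs arbitrary: A B)
  case Nil
  obtain t where "call f_cand [L U, L A, L B] = Some (enc_cand (cand U A B), t)" "t \<le> N ^ 7"
    using runs_cand[of U A B] assms(1,2) Nil by (auto elim: runsE)
  moreover have "length (fst (cand U A B)) \<le> N"
    using assms(2) by (auto simp: cand_def Let_def intro: order.trans[OF length_filter_le])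
  ultimately show ?case
    using N_powers by (simp add: runs_def call_unfold best_body_def sem_simps)
next
  case (Cons b bs)
  define r1 where "r1 = best bs (b @ A) B U"
  define r2 where "r2 = best bs A (b @ B) U"
  define T where "T = (2 ^ (length bs + 1) - 1) * N ^ 8"
  have T: "(2 ^ (length (b # bs) + 1) - 1) * N ^ 8 = T + T + N ^ 8"
    unfolding T_def by (cases "2 ^ (length bs + 1) :: nat") simp_all
  have r1: "runs f_best [LL bs, L (b @ A), L B, L U] (enc_cand r1) T" "length (fst r1) \<le> N"
    using Cons.IH[of "b @ A" B] Cons.prems by (simp_all add: r1_def T_def)
  have r2: "runs f_best [LL bs, L A, L (b @ B), L U] (enc_cand r2) T" "length (fst r2) \<le> N"
    using Cons.IH[of A "b @ B"] Cons.prems by (simp_all add: r2_def T_def)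
  have b: "length b \<le> N"
    using Cons.prems by simp
  have enc: "enc_cand r = Node (L (fst r)) (L (snd r))" for r
    by (cases r) simp
  obtain t1 where "call f_app [L b, L A] = Some (L (b @ A), t1)" "t1 \<le> N ^ 2"
    using runs_app_bounded[OF b] by (rule runsE)
  moreover obtain t2 where "call f_app [L b, L B] = Some (L (b @ B), t2)" "t2 \<le> N ^ 2"
    using runs_app_bounded[OF b] by (rule runsE)
  moreover obtain t3 where "call f_best [LL bs, L (b @ A), L B, L U] = Some (enc_cand r1, t3)" "t3 \<le> T"
    using r1(1) by (rule runsE)
  moreover obtain t4 where "call f_best [LL bs, L A, L (b @ B), L U] = Some (enc_cand r2, t4)" "t4 \<le> T"
    using r2(1) by (rule runsE)
  moreover obtain t5 where "call f_leq [L (fst r2), L (fst r1)] =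
      Some (tt (length (fst r2) \<le> length (fst r1)), t5)" "t5 \<le> N ^ 2"
    using runs_leq_bounded[OF r2(2)] by (rule runsE)
  moreover have "best (b # bs) A B U = (if length (fst r2) \<le> length (fst r1) then r1 else r2)"
    by (simp add: r1_def r2_def Let_def)
  ultimately show ?case
    unfolding T using N_powers r1(2) r2(2)
    by (cases "length (fst r2) \<le> length (fst r1)")
      (simp_all add: runs_def call_unfold(18)[of "[Node _ _, _, _, _]"] best_body_def sem_simps enc
        del: best.simps)
qed

lemma runs_best:
  assumes "bounded (set U)" "length U \<le> N" "length (concat bs) \<le> N" "length bs = 6"
  shows "runs f_best [LL bs, Atom, Atom, L U] (enc_cand (best bs [] [] U)) (N ^ 10)"
proof -
  \<comment> \<open>127 is \<open>2 ^ 7 - 1\<close>, the size of the recursion tree for six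
    blocks.\<close>
  have "127 * N ^ 8 \<le> N ^ 10"
    using N_powers by linarith
  then show ?thesis
    using runs_best'[of U bs "[]" "[]"] assms by (auto elim: runs_mono)
qed

end

section \<open>Search with backjumping\<close>

text \<open>\<open>\<sigma>\<close> lists the literals made false so far:
  \<open>Pos x # \<sigma>\<close> is the branch x = 0, and a clause is falsified iff it is contained
  in \<open>\<sigma>\<close>. \<open>Initial []\<close> is a default, never reached if the formula
  is unsatisfiable and all its variables are queried.\<close>

fun dpll :: "'v literal list list \<Rightarrow> 'v list \<Rightarrow> 'v literal list \<Rightarrow> 'v literal list proof_tree" where
  "dpll cs [] \<sigma> = (case find (\<lambda>c. set c \<subseteq> set \<sigma>) cs of Some c \<Rightarrow> Initial c | None \<Rightarrow> Initial [])"
| "dpll cs (x # xs) \<sigma> = (case find (\<lambda>c. set c \<subseteq> set \<sigma>) cs of Some c \<Rightarrow> Initial c | None \<Rightarrow>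
    (let R1 = dpll cs xs (Pos x # \<sigma>); R2 = dpll cs xs (Neg x # \<sigma>) in
      if Pos x \<notin> set (concl R1) then R1
      else if Neg x \<notin> set (concl R2) then R2
      else Resolve (union (filter (\<lambda>l. l \<notin> set [Pos x]) (concl R1))
        (filter (\<lambda>l. l \<notin> set [Neg x]) (concl R2))) R1 R2))"

text \<open>Counts the calls that the program makes. The term \<open>dpll\<close> mentions both
  branches, but the second is charged only if the first conclusion contains
  \<open>Pos x\<close>.\<close>

fun calls :: "'v literal list list \<Rightarrow> 'v list \<Rightarrow> 'v literal list \<Rightarrow> nat" where
  "calls cs [] \<sigma> = 1"
| "calls cs (x # xs) \<sigma> = (if \<exists>c\<in>set cs. set c \<subseteq> set \<sigma> then 1
    else 1 + calls cs xs (Pos x # \<sigma>) +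
      (if Pos x \<notin> set (concl (dpll cs xs (Pos x # \<sigma>))) then 0 else calls cs xs (Neg x # \<sigma>)))"

lemma find_cases:
  obtains (None) "find P xs = None" "\<not> (\<exists>x\<in>set xs. P x)"
  | (Some) x where "find P xs = Some x" "x \<in> set xs" "P x" "\<exists>x\<in>set xs. P x"
  by (cases "find P xs") (auto simp: find_None_iff find_Some_iff intro: nth_mem)

lemma concl_map_proof_tree: "concl (map_proof_tree f R) = f (concl R)"
  by (cases R) auto

lemma calls_falsified: "\<exists>c\<in>set cs. set c \<subseteq> set \<sigma> \<Longrightarrow> calls cs xs \<sigma> = 1"
  by (cases xs) auto

lemma set_concl_dpll: "set (concl (dpll cs xs \<sigma>)) \<subseteq> set \<sigma>"
proof (induction xs arbitrary: \<sigma>)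
  case Nil
  show ?case
    by (cases rule: find_cases[of "\<lambda>c. set c \<subseteq> set \<sigma>" cs]) auto
next
  case (Cons x xs)
  show ?case
  proof (cases rule: find_cases[of "\<lambda>c. set c \<subseteq> set \<sigma>" cs])
    case None
    with Cons.IH[of "Pos x # \<sigma>"] Cons.IH[of "Neg x # \<sigma>"] show ?thesis
      by (auto simp: Let_def)
  qed auto
qed

lemma distinct_concl_dpll:
  assumes "\<forall>c\<in>set cs. distinct c"
  shows "distinct (concl (dpll cs xs \<sigma>))"
proof (induction xs arbitrary: \<sigma>)
  case Nil
  with assms show ?case
    by (cases rule: find_cases[of "\<lambda>c. set c \<subseteq> set \<sigma>" cs]) auto
next
  case (Cons x xs)
  show ?case
  proof (cases rule: find_cases[of "\<lambda>c. set c \<subseteq> set \<sigma>" cs])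
    case None
    with Cons.IH[of "Pos x # \<sigma>"] Cons.IH[of "Neg x # \<sigma>"] show ?thesis
      by (auto simp: Let_def union_def)
  qed (use assms in auto)
qed

lemma length_concl_dpll:
  assumes "\<forall>c\<in>set cs. distinct c"
  shows "length (concl (dpll cs xs \<sigma>)) \<le> length \<sigma>"
  using distinct_card[OF distinct_concl_dpll[OF assms, of xs \<sigma>]]
    card_mono[OF finite_set set_concl_dpll[of cs xs \<sigma>]] card_length[of \<sigma>] by linarith

lemma derivation_dpll:
  assumes unsat: "\<And>\<alpha>. \<exists>c\<in>set cs. \<forall>l\<in>set c. \<not> sat_literal \<alpha> l"
    and "\<forall>c\<in>set cs. var ` set c \<subseteq> var ` set \<sigma> \<union> set xs"
  shows "derivation (set ` set cs) (map_proof_tree set (dpll cs xs \<sigma>))"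
  using assms(2)
proof (induction xs arbitrary: \<sigma>)
  case Nil
  \<comment> \<open>Any literal over a variable of \<open>\<sigma>\<close> that this assignment
    falsifies belongs to \<open>\<sigma>\<close>. All variables are set here, so a clause falsified
    by the assignment is contained in \<open>\<sigma>\<close>.\<close>
  obtain c where c: "c \<in> set cs" "\<forall>l\<in>set c. \<not> sat_literal (\<lambda>i. if Neg i \<in> set \<sigma> then 1 else 0) l"
    using unsat by blast
  have "l \<in> set \<sigma>" if "l \<in> set c" for l
  proof -
    from that c(1) Nil have "var l \<in> var ` set \<sigma>"
      by auto
    moreover have "\<not> sat_literal (\<lambda>i. if Neg i \<in> set \<sigma> then 1 else 0) l"
      using c(2) that by blast
    ultimately show ?thesis
      by (cases l) (auto split: if_splits, metis literal.exhaust_sel)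
  qed
  with c(1) have "\<exists>c\<in>set cs. set c \<subseteq> set \<sigma>"
    by blast
  then show ?case
    by (cases rule: find_cases[of "\<lambda>c. set c \<subseteq> set \<sigma>" cs]) auto
next
  case (Cons x xs)
  show ?case
  proof (cases rule: find_cases[of "\<lambda>c. set c \<subseteq> set \<sigma>" cs])
    case None
    define R1 where "R1 = dpll cs xs (Pos x # \<sigma>)"
    define R2 where "R2 = dpll cs xs (Neg x # \<sigma>)"
    have R: "derivation (set ` set cs) (map_proof_tree set R1)"
      "derivation (set ` set cs) (map_proof_tree set R2)"
      using Cons.IH[of "Pos x # \<sigma>"] Cons.IH[of "Neg x # \<sigma>"] Cons.prems by (auto simp: R1_def R2_def)
    have "resolvent (set (union (filter (\<lambda>l. l \<notin> set [Pos x]) (concl R1))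
        (filter (\<lambda>l. l \<notin> set [Neg x]) (concl R2)))) (set (concl R1)) (set (concl R2))"
      if "Pos x \<in> set (concl R1)" "Neg x \<in> set (concl R2)"
      unfolding resolvent_def using that by (intro exI[of _ x]) auto
    with R None(1) show ?thesis
      by (simp add: R1_def[symmetric] R2_def[symmetric] Let_def concl_map_proof_tree)
  qed auto
qed

text \<open>Adding 1 makes the recurrence additive: at a node with two branches,
  \<open>calls + 1\<close> is the sum of the same quantity over the branches. The later bounds keep
  this form.\<close>

lemma calls_le: "calls cs xs \<sigma> + 1 \<le> 2 ^ (length xs + 1)"
proof (induction xs arbitrary: \<sigma>)
  case (Cons x xs)
  have "(2 :: nat) \<le> 2 ^ (length xs + 1)"
    by simp
  with Cons.IH[of "Pos x # \<sigma>"] Cons.IH[of "Neg x # \<sigma>"] show ?case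
    by (auto simp del: power_Suc simp: power_Suc[of _ "Suc _"])
qed simp

lemma calls_append_le:
  assumes "\<And>\<sigma>. calls cs ys \<sigma> + 1 \<le> M"
  shows "calls cs (xs @ ys) \<sigma> + 1 \<le> 2 ^ length xs * M"
proof (induction xs arbitrary: \<sigma>)
  case (Cons x xs)
  have "2 \<le> M"
    using assms[of \<sigma>] by (cases ys) (auto split: if_splits)
  then have "2 \<le> 2 ^ length xs * M"
    using mult_le_mono[of 1 "2 ^ length xs" 2 M] by simp
  with Cons.IH[of "Pos x # \<sigma>"] Cons.IH[of "Neg x # \<sigma>"] show ?case
    by auto
qed (use assms in simp)

text \<open>A clause at a leaf is falsified by \<open>\<sigma>\<close> extended by literals over
  \<open>xs\<close>, and resolution introduces no literal that is absent from the leaves.\<close>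

lemma concl_dpll_avoids:
  assumes "\<forall>c\<in>set cs. set c \<subseteq> set \<sigma> \<union> Pos ` set xs \<union> Neg ` set xs \<longrightarrow> var ` set c \<inter> Z = {}"
  shows "var ` set (concl (dpll cs xs \<sigma>)) \<inter> Z = {}"
  using assms
proof (induction xs arbitrary: \<sigma>)
  case Nil
  then show ?case
    by (cases rule: find_cases[of "\<lambda>c. set c \<subseteq> set \<sigma>" cs]) auto
next
  case (Cons x xs)
  have IH: "var ` set (concl (dpll cs xs (l # \<sigma>))) \<inter> Z = {}" if "l \<in> {Pos x, Neg x}" for l
  proof (rule Cons.IH, intro ballI impI)
    fix c assume "c \<in> set cs" "set c \<subseteq> set (l # \<sigma>) \<union> Pos ` set xs \<union> Neg ` set xs"
    moreover from this have "set c \<subseteq> set \<sigma> \<union> Pos ` set (x # xs) \<union> Neg ` set (x # xs)"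
      using that by auto
    ultimately show "var ` set c \<inter> Z = {}"
      using Cons.prems by blast
  qed
  show ?case
  proof (cases rule: find_cases[of "\<lambda>c. set c \<subseteq> set \<sigma>" cs])
    case None
    with IH[of "Pos x"] IH[of "Neg x"] show ?thesis
      by (auto simp: Let_def)
  next
    case (Some c)
    then have "var ` set c \<inter> Z = {}"
      using Cons.prems by blast
    with Some show ?thesis
      by simp
  qed
qed

text \<open>When the search has passed \<open>as\<close> without falsifying a clause, everything that is refuted
  below mentions no variable of \<open>Z\<close>, so the search jumps back over all of \<open>as\<close> at once.\<close>

lemma calls_backjump:
  assumes sep: "\<forall>c\<in>set cs. var ` set c \<inter> Z \<noteq> {} \<longrightarrow> var ` set c \<inter> set bs = {}"
    and "set as \<subseteq> Z"
  shows "calls cs (as @ bs) \<sigma> + 1 \<le> 2 ^ (length as + 1) \<or>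
    calls cs (as @ bs) \<sigma> + 1 \<le> 2 ^ (length as + 1) + 2 ^ (length bs + 1) \<and>
      var ` set (concl (dpll cs (as @ bs) \<sigma>)) \<inter> Z = {}"
  using assms(2)
\<comment> \<open>\<open>Z\<close> stays fixed while \<open>as\<close> shrinks: jumping back
  requires that the conclusion avoid the variables already branched on as well.\<close>
proof (induction as arbitrary: \<sigma>)
  case Nil
  show ?case
  proof (cases "\<exists>c\<in>set cs. set c \<subseteq> set \<sigma>")
    case True
    then show ?thesis
      by (simp add: calls_falsified)
  next
    case False
    \<comment> \<open>A clause touching \<open>Z\<close> has no variable in \<open>bs\<close>. If it
      could be falsified below this point, it would be falsified already.\<close>
    have "var ` set c \<inter> Z = {}" if c: "c \<in> set cs" "set c \<subseteq> set \<sigma> \<union> Pos ` set bs \<union> Neg ` set bs" for c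
    proof (rule ccontr)
      assume "var ` set c \<inter> Z \<noteq> {}"
      with sep c(1) have "var ` set c \<inter> set bs = {}"
        by blast
      with c(2) have "set c \<subseteq> set \<sigma>"
        by force
      with False c(1) show False
        by blast
    qed
    then have "var ` set (concl (dpll cs bs \<sigma>)) \<inter> Z = {}"
      by (intro concl_dpll_avoids) blast
    moreover have "calls cs bs \<sigma> + 1 \<le> 2 ^ (length bs + 1)"
      by (rule calls_le)
    ultimately show ?thesis
      by auto
  qed
next
  case (Cons x as)
  let ?p = "Pos x # \<sigma>" and ?n = "Neg x # \<sigma>"
  have x: "x \<in> Z" and as: "set as \<subseteq> Z"
    using Cons.prems by auto
  define p :: nat where "p = 2 ^ length as"
  have p: "1 \<le> p"
    by (simp add: p_def)
  show ?case
  proof (cases "\<exists>c\<in>set cs. set c \<subseteq> set \<sigma>")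
    case True
    then have "calls cs ((x # as) @ bs) \<sigma> = 1"
      by (rule calls_falsified)
    moreover have "(2 :: nat) \<le> 2 ^ (length (x # as) + 1)"
      by simp
    ultimately show ?thesis
      by linarith
  next
    case False
    then have none: "find (\<lambda>c. set c \<subseteq> set \<sigma>) cs = None"
      by (auto simp: find_None_iff)
    show ?thesis
    proof (cases "Pos x \<in> set (concl (dpll cs (as @ bs) ?p))")
      case False
      \<comment> \<open>The second branch is skipped and the conclusion is inherited, so whichever
        alternative holds for the first branch carries over.\<close>
      with Cons.IH[OF as, of ?p] none \<open>\<not> (\<exists>c\<in>set cs. set c \<subseteq> set \<sigma>)\<close> p show ?thesis
        by (auto simp: Let_def p_def[symmetric])
    next
      case True
      \<comment> \<open>A conclusion that mentions \<open>x\<close> excludes the second alternative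
        for the first branch. That branch was cheap, and the cost of \<open>bs\<close> has not been
        paid yet.\<close>
      then have "\<not> var ` set (concl (dpll cs (as @ bs) ?p)) \<inter> Z = {}"
        using x by force
      with Cons.IH[OF as, of ?p] have calls_p: "calls cs (as @ bs) ?p + 1 \<le> 2 ^ (length as + 1)"
        by blast
      show ?thesis
      proof (cases "var ` set (concl (dpll cs (as @ bs) ?n)) \<inter> Z = {}")
        case True
        \<comment> \<open>Here the second branch may pay for \<open>bs\<close>, but its proof, free
          of \<open>x\<close>, becomes the result at this node, so the payment happens only
          once.\<close>
        then have "Neg x \<notin> set (concl (dpll cs (as @ bs) ?n))"
          using x by force
        with True calls_p Cons.IH[OF as, of ?n] none \<open>Pos x \<in> _\<close> \<open>\<not> (\<exists>c\<in>set cs. set c \<subseteq> set \<sigma>)\<close> show ?thesis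
          by (auto simp: Let_def)
      next
        case False
        with calls_p Cons.IH[OF as, of ?n] \<open>Pos x \<in> _\<close> \<open>\<not> (\<exists>c\<in>set cs. set c \<subseteq> set \<sigma>)\<close> show ?thesis
          by auto
      qed
    qed
  qed
qed

text \<open>Both alternatives of backjumping, taken with \<open>Z = set as\<close>, lie below the
  sum of the two powers. Full branching on \<open>xs\<close> multiplies this sum; the naive bound
  would have the product instead.\<close>

lemma calls_separated_le:
  assumes "\<forall>c\<in>set cs. var ` set c \<inter> set as \<noteq> {} \<longrightarrow> var ` set c \<inter> set bs = {}"
  shows "calls cs (xs @ as @ bs) \<sigma> + 1 \<le> 2 ^ length xs * (2 ^ (length as + 1) + 2 ^ (length bs + 1))"
proof (rule calls_append_le)
  show "calls cs (as @ bs) \<sigma> + 1 \<le> 2 ^ (length as + 1) + 2 ^ (length bs + 1)" for \<sigma>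
    using calls_backjump[OF assms subset_refl, of \<sigma>] by linarith
qed

section \<open>Splitting the blocks\<close>

text \<open>The enlarged block exceeds the old minimum by at most \<open>D\<close>, and that minimum
  is below every other block. Conversely, the other blocks were within \<open>D\<close> of the
  minimum, which has only grown.\<close>

lemma blocks_balanced:
  assumes "\<forall>K\<in>set Ks. length K \<le> D"
  shows "sorted (map length (blocks Ks)) \<and>
    (\<forall>b\<in>set (blocks Ks). \<forall>b'\<in>set (blocks Ks). length b \<le> length b' + D)"
  using assms
proof (induction Ks)
  case Nil
  show ?case
    by (simp add: blocks_Nil)
next
  case (Cons K Ks)
  obtain b0 bs where bs: "blocks Ks = b0 # bs"
    by (cases "blocks Ks") auto
  have IH: "sorted (map length (b0 # bs))"
    "\<forall>b\<in>set (b0 # bs). \<forall>b'\<in>set (b0 # bs). length b \<le> length b' + D"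
    using Cons bs by auto
  have K: "length K \<le> D"
    using Cons.prems by simp
  have min: "length b0 \<le> length b" if "b \<in> set bs" for b
    using IH(1) that by simp
  have new: "blocks (K # Ks) = insort_key length (K @ b0) bs"
    by (simp add: blocks_Cons bs)
  have "length b \<le> length b' + D"
    if "b \<in> insert (K @ b0) (set bs)" "b' \<in> insert (K @ b0) (set bs)" for b b'
    using that IH(2) K min by (fastforce simp: trans_le_add1)
  moreover have "sorted (map length (insort_key length (K @ b0) bs))"
    using IH(1) by (simp add: sorted_insort_key)
  ultimately show ?case
    unfolding new set_insort_key by blast
qed

lemma blocks_cover:
  assumes "K \<in> set Ks"
  shows "\<exists>b\<in>set (blocks Ks). set K \<subseteq> set b"
  using assms
proof (induction Ks)
  case (Cons K' Ks)
  obtain b0 bs where bs: "blocks Ks = b0 # bs"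
    by (cases "blocks Ks") auto
  from Cons show ?case
    by (auto simp: blocks_Cons bs set_insort_key)
qed simp

fun splits :: "'a list list \<Rightarrow> 'a list \<Rightarrow> 'a list \<Rightarrow> ('a list \<times> 'a list) set" where
  "splits [] A B = {(A, B)}"
| "splits (b # bs) A B = splits bs (b @ A) B \<union> splits bs A (b @ B)"

lemma best_splits:
  "\<exists>(A', B')\<in>splits bs A B. best bs A B U = cand U A' B'"
proof (induction bs arbitrary: A B)
  case (Cons b bs)
  from Cons[of "b @ A" B] Cons[of A "b @ B"] show ?case
    by (auto simp: Let_def)
qed simp

lemma best_max:
  "(A', B') \<in> splits bs A B \<Longrightarrow> length (fst (cand U A' B')) \<le> length (fst (best bs A B U))"
proof (induction bs arbitrary: A B)
  case (Cons b bs)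
  from Cons.prems Cons.IH[of "b @ A" B] Cons.IH[of A "b @ B"] show ?case
    by (fastforce simp: Let_def)
qed simp

lemma mset_splits:
  "(A', B') \<in> splits bs A B \<Longrightarrow> mset A' + mset B' = mset A + mset B + mset (concat bs)"
  by (induction bs arbitrary: A B) (auto simp: ac_simps)

lemma splits_mono:
  "(A', B') \<in> splits bs A B \<Longrightarrow> set A \<subseteq> set A' \<and> set B \<subseteq> set B'"
proof (induction bs arbitrary: A B)
  case (Cons b bs)
  from Cons.prems consider "(A', B') \<in> splits bs (b @ A) B" | "(A', B') \<in> splits bs A (b @ B)"
    by auto
  then show ?case
    by cases (auto dest!: Cons.IH)
qed simp

lemma splits_cover:
  "(A', B') \<in> splits bs A B \<Longrightarrow> b \<in> set bs \<Longrightarrow> set b \<subseteq> set A' \<or> set b \<subseteq> set B'"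
proof (induction bs arbitrary: A B)
  case (Cons b' bs)
  from Cons.prems(1) consider "(A', B') \<in> splits bs (b' @ A) B" | "(A', B') \<in> splits bs A (b' @ B)"
    by auto
  then show ?case
  proof cases
    case 1
    with splits_mono[OF 1] Cons.IH[OF 1] Cons.prems(2) show ?thesis
      by auto
  next
    case 2
    with splits_mono[OF 2] Cons.IH[OF 2] Cons.prems(2) show ?thesis
      by auto
  qed
qed simp

fun deal :: "bool list \<Rightarrow> 'a list list \<Rightarrow> 'a list \<Rightarrow> 'a list \<Rightarrow> 'a list \<times> 'a list" where
  "deal (p # ps) (b # bs) A B = (if p then deal ps bs (b @ A) B else deal ps bs A (b @ B))"
| "deal _ _ A B = (A, B)"

lemma deal_in_splits: "length ps = length bs \<Longrightarrow> deal ps bs A B \<in> splits bs A B"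
  by (induction ps bs arbitrary: A B rule: list_induct2) auto

text \<open>All splits into three and three blocks up to exchanging the sides. Elements of two different
  blocks are on the same side in four of the ten splits.\<close>

definition halves :: "'a list list \<Rightarrow> ('a list \<times> 'a list) list" where
  "halves bs = map (\<lambda>ps. deal ps bs [] [])
    [[True, True, True, False, False, False],
     [True, True, False, True, False, False],
     [True, True, False, False, True, False],
     [True, True, False, False, False, True],
     [True, False, True, True, False, False],
     [True, False, True, False, True, False],
     [True, False, True, False, False, True],
     [True, False, False, True, True, False],
     [True, False, False, True, False, True],
     [True, False, False, False, True, True]]"

lemma length_6E:
  assumes "length bs = 6"
  obtains b0 b1 b2 b3 b4 b5 where "bs = [b0, b1, b2, b3, b4, b5]"
  using assms by (auto simp: numeral_eq_Suc length_Suc_conv)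

lemma halves_in_splits:
  assumes "length bs = 6"
  shows "set (halves bs) \<subseteq> splits bs [] []"
  using assms by (auto simp: halves_def deal_in_splits)

lemma halves_balanced:
  assumes "length bs = 6" "\<forall>b\<in>set bs. \<forall>b'\<in>set bs. length b \<le> length b' + D"
    and "(A, B) \<in> set (halves bs)"
  shows "length A \<le> length B + 3 * D" "length B \<le> length A + 3 * D"
proof -
  obtain b0 b1 b2 b3 b4 b5 where bs: "bs = [b0, b1, b2, b3, b4, b5]"
    using assms(1) by (rule length_6E)
  define m where "m = Min (length ` set bs)"
  have "m \<in> length ` set bs"
    unfolding m_def by (rule Min_in) (auto simp: bs)
  then have le: "length b \<le> m + D" if "b \<in> set bs" for b
    using assms(2) that by auto
  have ge: "m \<le> length b" if "b \<in> set bs" for b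
    unfolding m_def using that by (intro Min_le) auto
  note bounds = le[of b0] le[of b1] le[of b2] le[of b3] le[of b4] le[of b5]
    ge[of b0] ge[of b1] ge[of b2] ge[of b3] ge[of b4] ge[of b5]
  \<comment> \<open>A side consists of three blocks, each of length between \<open>m\<close> and
    \<open>m + D\<close>.\<close>
  have "length A \<le> 3 * (m + D) \<and> length B \<le> 3 * (m + D) \<and> 3 * m \<le> length A \<and> 3 * m \<le> length B"
    using assms(3) bounds by (auto simp: bs halves_def)
  then show "length A \<le> length B + 3 * D" "length B \<le> length A + 3 * D"
    by auto
qed

text \<open>An element occurs only once in \<open>A\<close> and \<open>B\<close> together if it is an edge to a leaf, since the star
  of the leaf is covered by the star of its neighbour. The second term corrects for this.\<close>

definition gain :: "'a list \<Rightarrow> 'a list \<Rightarrow> 'a \<Rightarrow> int" where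
  "gain A B x = (if x \<notin> set A \<or> x \<notin> set B then 2 else 0) -
    (if count_list A x + count_list B x = 1 then 1 else 0)"

text \<open>For edges occurring twice this is degree counting: with i and j inner edges and k
  crossing ones, \<open>length A\<close> is 2i + k and \<open>length B\<close> is 2j + k, so the
  total gain 2i + 2j equals 4i + \<open>length B\<close> - \<open>length A\<close>.\<close>

lemma gain_le:
  assumes "distinct U" "set A \<union> set B = set U"
    and "\<And>x. x \<in> set U \<Longrightarrow> count_list A x + count_list B x \<le> 2"
  shows "(\<Sum>x\<in>set U. gain A B x) \<le>
    4 * int (length (filter (\<lambda>x. x \<notin> set B) U)) + int (length B) - int (length A)"
proof -
  have len: "int (length C) = (\<Sum>x\<in>set U. int (count_list C x))" if "set C \<subseteq> set U" for C
    using sum_count_set[OF that finite_set] by (metis of_nat_sum)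
  have filter: "int (length (filter (\<lambda>x. x \<notin> set B) U)) = (\<Sum>x\<in>set U. if x \<notin> set B then 1 else 0)"
    using assms(1) by (simp add: distinct_length_filter Int_def conj_commute sum.If_cases flip: of_nat_sum)
  \<comment> \<open>By the counts in \<open>A\<close> and \<open>B\<close>: (2,0) gives 2 = 4 - 2,
    (0,2) gives 2 = 2, (1,1) gives 0 = 0, (0,1) gives 1 = 1, and only (1,0) is strict, with 1 <
    3.\<close>
  have "gain A B x \<le> 4 * (if x \<notin> set B then 1 else 0) + int (count_list B x) - int (count_list A x)"
    if "x \<in> set U" for x
  proof -
    have "x \<notin> set A \<longleftrightarrow> count_list A x = 0" "x \<notin> set B \<longleftrightarrow> count_list B x = 0"
      by (simp_all add: count_list_0_iff)
    moreover have "x \<in> set A \<or> x \<in> set B"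
      using assms(2) that by blast
    ultimately show ?thesis
      using assms(3)[OF that] unfolding gain_def by (auto split: if_splits)
  qed
  then have "(\<Sum>x\<in>set U. gain A B x) \<le>
      (\<Sum>x\<in>set U. 4 * (if x \<notin> set B then 1 else 0) + int (count_list B x) - int (count_list A x))"
    by (rule sum_mono)
  also have "\<dots> = 4 * (\<Sum>x\<in>set U. if x \<notin> set B then 1 else 0) +
      (\<Sum>x\<in>set U. int (count_list B x)) - (\<Sum>x\<in>set U. int (count_list A x))"
    by (simp only: sum.distrib sum_subtractf sum_distrib_left)
  finally show ?thesis
    using len[of A] len[of B] assms(2)[symmetric] unfolding filter by simp
qed

lemma gain_commute: "gain A B x = gain B A x"
  by (auto simp: gain_def)

text \<open>In terms of counts, averaging over the ten splits becomes a statement about six numbers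
  with sum 1 or 2.\<close>

definition count_gain :: "nat \<Rightarrow> nat \<Rightarrow> int" where
  "count_gain a b = (if a = 0 \<or> b = 0 then 2 else 0) - (if a + b = 1 then 1 else 0)"

lemma gain_eq_count_gain: "gain A B x = count_gain (count_list A x) (count_list B x)"
  by (simp add: gain_def count_gain_def count_list_0_iff)

text \<open>Two occurrences in one block gain 2 in all ten splits; in two blocks they gain 2 in four
  splits, the tight case; a single occurrence gains 1 in each split.\<close>

lemma sum_count_gain_halves:
  fixes n0 n1 n2 n3 n4 n5 :: nat
  assumes "1 \<le> n0 + n1 + n2 + n3 + n4 + n5" "n0 + n1 + n2 + n3 + n4 + n5 \<le> 2"
  shows "8 \<le> count_gain (n2+n1+n0) (n5+n4+n3) + count_gain (n3+n1+n0) (n5+n4+n2) +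
  count_gain (n4+n1+n0) (n5+n3+n2) +
      count_gain (n5+n1+n0) (n4+n3+n2) +
      count_gain (n3+n2+n0) (n5+n4+n1) +
      count_gain (n4+n2+n0) (n5+n3+n1) +
      count_gain (n5+n2+n0) (n4+n3+n1) +
      count_gain (n4+n3+n0) (n5+n2+n1) +
      count_gain (n5+n3+n0) (n4+n2+n1) +
      count_gain (n5+n4+n0) (n3+n2+n1)"
proof (cases "n0 + n1 + n2 + n3 + n4 + n5 = 1")
  case True
  have "count_gain a b = 1" if "a + b = n0 + n1 + n2 + n3 + n4 + n5" for a b
    using that True by (auto simp: count_gain_def)
  then show ?thesis
    by simp
next
  case False
  with assms have sum: "n0 + n1 + n2 + n3 + n4 + n5 = 2"
    by linarith
  have gain: "count_gain a b = (if a = 0 \<or> b = 0 then 2 else 0)" if "a + b = n0 + n1 + n2 + n3 + n4 + n5" for a b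
    using that sum by (simp add: count_gain_def)
  show ?thesis
    using sum by (simp add: gain)
qed

lemma sum_gain_halves:
  assumes "length bs = 6" "count_list (concat bs) x \<in> {1, 2}"
  shows "8 \<le> (\<Sum>h\<leftarrow>halves bs. gain (fst h) (snd h) x)"
proof -
  obtain b0 b1 b2 b3 b4 b5 where bs: "bs = [b0, b1, b2, b3, b4, b5]"
    using assms(1) by (rule length_6E)
  have "count_list b0 x + count_list b1 x + count_list b2 x + count_list b3 x +
      count_list b4 x + count_list b5 x \<in> {1, 2}"
    using assms(2) by (simp add: bs add.assoc)
  then have "1 \<le> count_list b0 x + count_list b1 x + count_list b2 x + count_list b3 x +
      count_list b4 x + count_list b5 x" "count_list b0 x + count_list b1 x + count_list b2 x +
      count_list b3 x + count_list b4 x + count_list b5 x \<le> 2"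
    by auto
  from sum_count_gain_halves[OF this] show ?thesis
    by (simp add: bs halves_def gain_eq_count_gain ac_simps)
qed

lemma sum_sum_list_swap:
  fixes g :: "'b \<Rightarrow> 'a \<Rightarrow> 'c :: comm_monoid_add"
  shows "(\<Sum>x\<in>X. \<Sum>h\<leftarrow>hs. g h x) = (\<Sum>h\<leftarrow>hs. \<Sum>x\<in>X. g h x)"
  by (induction hs) (simp_all add: sum.distrib)

lemma sum_list_less:
  fixes g :: "'a \<Rightarrow> int"
  shows "hs \<noteq> [] \<Longrightarrow> (\<And>h. h \<in> set hs \<Longrightarrow> g h < c) \<Longrightarrow> (\<Sum>h\<leftarrow>hs. g h) < int (length hs) * c"
proof (induction hs rule: list_nonempty_induct)
  case (cons h hs)
  have "g h < c" "(\<Sum>h\<leftarrow>hs. g h) < int (length hs) * c"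
    using cons by auto
  then show ?case
    by (simp add: distrib_right)
qed simp

lemma exists_half:
  assumes "length bs = 6" and "\<And>x. x \<in> X \<Longrightarrow> count_list (concat bs) x \<in> {1, 2}"
  shows "\<exists>h\<in>set (halves bs). 8 * int (card X) \<le> 10 * (\<Sum>x\<in>X. gain (fst h) (snd h) x)"
proof (rule ccontr)
  assume "\<not> ?thesis"
  then have less: "10 * (\<Sum>x\<in>X. gain (fst h) (snd h) x) < 8 * int (card X)" if "h \<in> set (halves bs)" for h
    using that by (simp add: not_le)
  have len: "length (halves bs) = 10"
    by (simp add: halves_def)
  have "8 * int (card X) = (\<Sum>x\<in>X. 8)"
    by simp
  also have "\<dots> \<le> (\<Sum>x\<in>X. \<Sum>h\<leftarrow>halves bs. gain (fst h) (snd h) x)"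
    using sum_gain_halves[OF assms] by (rule sum_mono)
  also have "\<dots> = (\<Sum>h\<leftarrow>halves bs. \<Sum>x\<in>X. gain (fst h) (snd h) x)"
    by (rule sum_sum_list_swap)
  finally have "80 * int (card X) \<le> 10 * (\<Sum>h\<leftarrow>halves bs. \<Sum>x\<in>X. gain (fst h) (snd h) x)"
    by linarith
  also have "\<dots> = (\<Sum>h\<leftarrow>halves bs. 10 * (\<Sum>x\<in>X. gain (fst h) (snd h) x))"
    by (rule sum_list_const_mult[symmetric])
  also have "\<dots> < int (length (halves bs)) * (8 * int (card X))"
    using len less by (intro sum_list_less) auto
  finally show False
    unfolding len by simp
qed

text \<open>Some even split satisfies \<open>8 * m \<le> 10 * g\<close>, where g is its total gain
  and m the length of \<open>U\<close>, and g is at most four times the inner edges of either side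
  plus \<open>3 * D\<close>. Eliminating g gives the constants. \<open>gain_le\<close> is applied in
  both orders because either side may be the smaller one.\<close>

lemma best_score:
  assumes "length bs = 6" "distinct U" "set U = set (concat bs)"
    and count: "\<And>x. x \<in> set U \<Longrightarrow> count_list (concat bs) x \<le> 2"
    and bal: "\<forall>b\<in>set bs. \<forall>b'\<in>set bs. length b \<le> length b' + D"
  shows "4 * length U \<le> 20 * length (fst (best bs [] [] U)) + 15 * D"
proof -
  have "count_list (concat bs) x \<in> {1, 2}" if "x \<in> set U" for x
  proof -
    have "count_list (concat bs) x \<noteq> 0"
      using that assms(3) by (simp add: count_list_0_iff)
    with count[OF that] show ?thesis
      by auto
  qed
  from exists_half[OF assms(1) this]
  obtain A B where AB: "(A, B) \<in> set (halves bs)" "8 * int (card (set U)) \<le> 10 * (\<Sum>x\<in>set U. gain A B x)"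
    by force
  have split: "(A, B) \<in> splits bs [] []"
    using halves_in_splits[OF assms(1)] AB(1) by blast
  then have mset: "mset A + mset B = mset (concat bs)"
    using mset_splits[of A B bs "[]" "[]"] by simp
  then have "set_mset (mset A + mset B) = set_mset (mset (concat bs))"
    by (rule arg_cong)
  then have AB_U: "set A \<union> set B = set U"
    using assms(3) by simp
  have cnt: "count_list A x + count_list B x \<le> 2" if "x \<in> set U" for x
    using count[OF that] mset by (metis count_mset count_union)
  have "(\<Sum>x\<in>set U. gain A B x) \<le>
    4 * int (length (filter (\<lambda>x. x \<notin> set B) U)) + int (length B) - int (length A)"
    using gain_le[OF assms(2) AB_U cnt] by simp
  moreover have "(\<Sum>x\<in>set U. gain A B x) \<le>
    4 * int (length (filter (\<lambda>x. x \<notin> set A) U)) + int (length A) - int (length B)"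
    using gain_le[OF assms(2), of B A] AB_U cnt gain_commute[of A B] by (simp add: Un_commute add.commute)
  moreover have "length (fst (cand U A B)) \<le> length (fst (best bs [] [] U))"
    using split by (rule best_max)
  then have "length (filter (\<lambda>x. x \<notin> set B) U) \<le> length (fst (best bs [] [] U)) \<or>
      length (filter (\<lambda>x. x \<notin> set A) U) \<le> length (fst (best bs [] [] U))"
    by (auto simp: cand_def Let_def split: if_splits)
  moreover note halves_balanced[OF assms(1) bal AB(1)] AB(2) distinct_card[OF assms(2)]
  ultimately show ?thesis
    by linarith
qed

section \<open>Cost of the search\<close>

lemma inj_enc_nat: "inj enc_nat"
proof (rule injI)
  show "enc_nat x = enc_nat y \<Longrightarrow> x = y" for x y
  proof (induction x arbitrary: y)
    case 0
    then show ?case by (cases y) auto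
  next
    case (Suc x)
    then show ?case by (cases y) auto
  qed
qed

lemma inj_enc_literal: "inj enc_literal"
proof (rule injI)
  show "enc_literal k = enc_literal l \<Longrightarrow> k = l" for k l
    using inj_enc_nat by (cases k; cases l) (auto dest: injD)
qed

lemma size_enc_nat [simp]: "size (enc_nat n) = n"
  by (induction n) auto

lemma size_enc_literal: "size (enc_literal l) \<le> var l + 2"
  by (cases l) auto

lemma second_enc_literal [simp]: "second (enc_literal l) = enc_nat (var l)"
  by (cases l) auto

lemma second_enc_proof [simp]: "second (enc_proof R) = enc_clause (concl R)"
  by (cases R) auto

lemma enc_proof_not_Atom [simp]: "enc_proof R \<noteq> Atom"
  by (cases R) auto

lemma runs_vars: "runs f_vars [enc_clause c] (enc_list enc_nat (map var c)) (20 * (length c + 1))"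
proof (induction c)
  case Nil
  show ?case
    by (simp add: runs_def call_unfold vars_body_def sem_simps enc_clause_def)
next
  case (Cons l c)
  obtain t where "call f_vars [enc_list enc_literal c] = Some (enc_list enc_nat (map var c), t)"
    "t \<le> 20 * (length c + 1)"
    using Cons.IH unfolding enc_clause_def by (rule runsE)
  then show ?case
    by (simp add: runs_def call_unfold(10)[of "[Node _ _]"] vars_body_def sem_simps enc_clause_def)
qed

lemma set_stars: "set (stars Is) \<subseteq> set Is"
  by (induction Is) (auto simp: Let_def)

lemma length_stars: "length (stars Is) \<le> length Is"
  by (induction Is) (auto simp: Let_def)

lemma stars_cover: "I \<in> set Is \<Longrightarrow> \<exists>K\<in>set (stars Is). set I \<subseteq> set K"
  by (induction Is) (auto simp: Let_def)

lemma distinct_map_set_stars: "distinct (map set (stars Is))"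
  by (induction Is) (auto simp: Let_def)

lemma runs_stars:
  assumes N: "64 \<le> N"
    and cs: "\<forall>c\<in>set cs. length c \<le> N \<and> (\<forall>l\<in>set c. var l \<le> N)" and "length cs \<le> N"
  shows "runs f_stars [enc_cnf cs] (enc_list (enc_list enc_nat) (stars (map (map var) cs))) (N ^ 11)"
proof -
  interpret bounded_encoding enc_nat N
    using inj_enc_nat N by unfold_locales
  have "runs f_stars [enc_cnf cs] (LL (stars (map (map var) cs))) ((N ^ 9 + 20) * (length cs + 1))"
    using assms(2,3)
  proof (induction cs)
    case Nil
    show ?case
      by (simp add: runs_def call_unfold stars_body_def sem_simps enc_cnf_def)
  next
    case (Cons c cs)
    let ?I = "map var c" and ?Ks = "stars (map (map var) cs)"
    have I: "bounded (set ?I)" "length ?I \<le> N"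
      using Cons.prems by (auto simp: bounded_def)
    have "\<forall>K\<in>set ?Ks. length K \<le> N"
      using set_stars[of "map (map var) cs"] Cons.prems by auto
    moreover have "length ?Ks \<le> N"
      using length_stars[of "map (map var) cs"] Cons.prems(2) by simp
    ultimately obtain s where
      "call f_covered [L ?I, LL ?Ks] = Some (tt (\<exists>K\<in>set ?Ks. set ?I \<subseteq> set K), s)" "s \<le> N ^ 8"
      using runs_covered[OF I] by (blast elim: runsE)
    moreover obtain u where "call f_vars [enc_clause c] = Some (L ?I, u)" "u \<le> 20 * (length c + 1)"
      using runs_vars by (rule runsE)
    moreover have "20 * (length c + 1) \<le> N ^ 2"
      using bound_step[OF N, of 0 0 "length c"] Cons.prems by (simp add: power2_eq_square)
    moreover obtain t where "call f_stars [enc_list enc_clause cs] = Some (LL ?Ks, t)"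
      "t \<le> (N ^ 9 + 20) * (length cs + 1)"
      using Cons by (auto elim: runsE simp: enc_cnf_def)
    ultimately show ?case
      using N_powers by (cases "\<exists>K\<in>set ?Ks. set ?I \<subseteq> set K")
        (simp_all add: runs_def call_unfold(12)[of "[Node _ _]"] stars_body_def sem_simps enc_cnf_def
          Let_def)
  qed
  then show ?thesis
    using bound_step[OF N, of "N ^ 9" 9 "length cs"] assms(3) by (auto elim: runs_mono)
qed

lemma calls_pos: "1 \<le> calls cs xs \<sigma>"
  by (cases xs) auto

text \<open>Outside its recursive calls, a call costs at most \<open>N ^ 9\<close>, dominated by
  \<open>f_find\<close>. Distinct clauses keep each conclusion no longer than
  \<open>\<sigma>\<close>, hence all list operations within \<open>N\<close>.\<close>

lemma runs_solve:
  assumes N: "64 \<le> N"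
    and cs: "\<forall>c\<in>set cs. distinct c \<and> length c \<le> N \<and> (\<forall>l\<in>set c. var l + 2 \<le> N)" "length cs \<le> N"
    and "\<forall>x\<in>set xs. x + 2 \<le> N" "\<forall>l\<in>set \<sigma>. var l + 2 \<le> N" "length \<sigma> + length xs \<le> N"
  shows "runs f_solve [enc_list enc_nat xs, enc_clause \<sigma>, enc_cnf cs] (enc_proof (dpll cs xs \<sigma>))
    (calls cs xs \<sigma> * N ^ 9)"
  using assms(4-6)
proof (induction xs arbitrary: \<sigma>)
  case (Nil \<sigma>)
  interpret bounded_encoding enc_literal N
    using inj_enc_literal N by unfold_locales
  have lit: "size (enc_literal l) \<le> N" if "var l + 2 \<le> N" for l
    using size_enc_literal[of l] that by linarith
  obtain s where s: "call f_find [LL cs, L \<sigma>] =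
      Some (case find (\<lambda>c. set c \<subseteq> set \<sigma>) cs of None \<Rightarrow> Atom | Some c \<Rightarrow> Node Atom (L c), s)" "s \<le> N ^ 8"
    using runs_find[of cs \<sigma>] cs Nil.prems lit by (auto elim: runsE simp: bounded_def)
  then show ?case
    using N_powers
    by (cases rule: find_cases[of "\<lambda>c. set c \<subseteq> set \<sigma>" cs])
      (simp_all add: runs_def call_unfold solve_body_def sem_simps enc_clause_def enc_cnf_def)
next
  case (Cons x xs \<sigma>)
  interpret bounded_encoding enc_literal N
    using inj_enc_literal N by unfold_locales
  have lit: "size (enc_literal l) \<le> N" if "var l + 2 \<le> N" for l
    using size_enc_literal[of l] that by linarith
  define c where "c = calls cs xs (Pos x # \<sigma>)"
  define d where "d = calls cs xs (Neg x # \<sigma>)"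
  obtain s where s: "call f_find [LL cs, L \<sigma>] =
      Some (case find (\<lambda>c. set c \<subseteq> set \<sigma>) cs of None \<Rightarrow> Atom | Some c \<Rightarrow> Node Atom (L c), s)" "s \<le> N ^ 8"
    using runs_find[of cs \<sigma>] cs Cons.prems lit by (auto elim: runsE simp: bounded_def)
  show ?case
  proof (cases rule: find_cases[of "\<lambda>c. set c \<subseteq> set \<sigma>" cs])
    case (Some C)
    with s show ?thesis
      using N_powers
      by (simp add: runs_def call_unfold(9)[of "[Node _ _, _, _]"] solve_body_def sem_simps enc_clause_def enc_cnf_def)
  next
    case None
    define R1 where "R1 = dpll cs xs (Pos x # \<sigma>)"
    define R2 where "R2 = dpll cs xs (Neg x # \<sigma>)"
    define c1 where "c1 = concl R1"
    define c2 where "c2 = concl R2"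
    define e1 where "e1 = filter (\<lambda>l. l \<notin> set [Pos x]) c1"
    define e2 where "e2 = filter (\<lambda>l. l \<notin> set [Neg x]) c2"
    have dist: "\<forall>c\<in>set cs. distinct c"
      using cs by blast
    have c12: "set c1 \<subseteq> set (Pos x # \<sigma>)" "set c2 \<subseteq> set (Neg x # \<sigma>)"
      unfolding c1_def c2_def R1_def R2_def by (rule set_concl_dpll)+
    have len: "length c1 \<le> N" "length c2 \<le> N"
      using length_concl_dpll[OF dist, of xs "Pos x # \<sigma>"] length_concl_dpll[OF dist, of xs "Neg x # \<sigma>"]
        Cons.prems(3) by (simp_all add: c1_def c2_def R1_def R2_def)
    have len': "length e1 \<le> N" "length e2 \<le> N"
      using len unfolding e1_def e2_def by (meson le_trans length_filter_le)+
    have "bounded (set (Pos x # \<sigma>))" "bounded (set (Neg x # \<sigma>))"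
      using Cons.prems(1,2) lit by (auto simp: bounded_def)
    then have bdd: "bounded (set c1)" "bounded (set c2)"
      using c12 by (blast intro: bounded_mono)+
    then have bdd': "bounded (set e1)"
      by (auto simp: e1_def bounded_def)
    have sz: "size (enc_literal (Pos x)) \<le> N" "size (enc_literal (Neg x)) \<le> N"
      using Cons.prems(1) by (auto intro: lit)
    obtain t1 where "call f_solve [enc_list enc_nat xs, L (Pos x # \<sigma>), LL cs] = Some (enc_proof R1, t1)"
      "t1 \<le> c * N ^ 9"
      using Cons.IH[of "Pos x # \<sigma>"] Cons.prems
      by (auto elim: runsE simp: R1_def c_def enc_clause_def enc_cnf_def)
    moreover obtain t2 where "call f_solve [enc_list enc_nat xs, L (Neg x # \<sigma>), LL cs] = Some (enc_proof R2, t2)"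
      "t2 \<le> d * N ^ 9"
      using Cons.IH[of "Neg x # \<sigma>"] Cons.prems
      by (auto elim: runsE simp: R2_def d_def enc_clause_def enc_cnf_def)
    moreover obtain t3 where "call f_mem [enc_literal (Pos x), L c1] = Some (tt (Pos x \<in> set c1), t3)"
      "t3 \<le> N ^ 4"
      using runs_mem[OF sz(1) len(1)] by (rule runsE)
    moreover obtain t4 where "call f_mem [enc_literal (Neg x), L c2] = Some (tt (Neg x \<in> set c2), t4)"
      "t4 \<le> N ^ 4"
      using runs_mem[OF sz(2) len(2)] by (rule runsE)
    moreover obtain t5 where "call f_diff [L c1, L [Pos x]] = Some (L e1, t5)" "t5 \<le> N ^ 6"
      using runs_diff[OF bdd(1) len(1), of "[Pos x]"] N unfolding e1_def by (auto elim: runsE)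
    moreover obtain t6 where "call f_diff [L c2, L [Neg x]] = Some (L e2, t6)" "t6 \<le> N ^ 6"
      using runs_diff[OF bdd(2) len(2), of "[Neg x]"] N unfolding e2_def by (auto elim: runsE)
    moreover obtain t7 where "call f_union [L e1, L e2] = Some (L (union e1 e2), t7)" "t7 \<le> N ^ 7"
      using runs_union[OF bdd' len'] by (rule runsE)
    moreover have "dpll cs (x # xs) \<sigma> = (if Pos x \<notin> set c1 then R1 else if Neg x \<notin> set c2 then R2
        else Resolve (union e1 e2) R1 R2)"
      unfolding c1_def c2_def e1_def e2_def R1_def R2_def using None(1) by (simp add: Let_def)
    moreover have "calls cs (x # xs) \<sigma> = 1 + c + (if Pos x \<notin> set c1 then 0 else d)"
      using None(2) by (simp add: c_def d_def c1_def R1_def)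
    moreover have "call f_find [LL cs, L \<sigma>] = Some (Atom, s)"
      using s(1) None(1) by simp
    moreover have "call f_solve [enc_list enc_nat (x # xs), enc_clause \<sigma>, enc_cnf cs] =
        sem prog [enc_list enc_nat (x # xs), enc_clause \<sigma>, enc_cnf cs] solve_body"
      by (rule call_unfold)
    ultimately show ?thesis
      using N_powers s(2)
      by (cases "Pos x \<in> set c1"; cases "Neg x \<in> set c2")
        (simp_all add: runs_def solve_body_def sem_simps enc_clause_def enc_cnf_def
          c1_def[symmetric] c2_def[symmetric] algebra_simps del: dpll.simps calls.simps)
  qed
qed

lemma size_enc_clause_le:
  assumes "\<forall>l\<in>set c. var l + 2 \<le> N" "length c \<le> N" "64 \<le> N"
  shows "size (enc_clause c) + 2 \<le> N ^ 3"
proof -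
  have "size (enc_clause c) \<le> length c * (N + 1)"
    using assms(1)
  proof (induction c)
    case (Cons l c)
    then show ?case
      using size_enc_literal[of l] by (auto simp: enc_clause_def)
  qed (simp add: enc_clause_def)
  also have "\<dots> \<le> N * (N + 1)"
    using assms(2) by (rule mult_le_mono1)
  also have "\<dots> = N ^ 2 + N"
    by (simp add: power2_eq_square)
  finally have "size (enc_clause c) \<le> N ^ 2 + N" .
  moreover have "N \<le> N ^ 2"
    using assms(3) by (intro self_le_power) auto
  ultimately have "size (enc_clause c) + 2 \<le> 64 * N ^ 2"
    using assms(3) by linarith
  also have "\<dots> \<le> N ^ 3"
    using bound_sum(2)[OF assms(3) le_refl, of 2] by simp
  finally show ?thesis .
qed

text \<open>Each call adds at most one proof node, and a node with its clause has size at most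
  \<open>N ^ 3\<close>. A subproof enters the output at most once, so writing it without sharing
  costs no more.\<close>

lemma size_enc_proof_le:
  assumes N: "64 \<le> N" and dist: "\<forall>c\<in>set cs. distinct c"
    and "\<forall>x\<in>set xs. x + 2 \<le> N" "\<forall>l\<in>set \<sigma>. var l + 2 \<le> N" "length \<sigma> + length xs \<le> N"
  shows "size (enc_proof (dpll cs xs \<sigma>)) \<le> calls cs xs \<sigma> * N ^ 3"
  using assms(3-5)
proof (induction xs arbitrary: \<sigma>)
  case (Nil \<sigma>)
  have "size (enc_clause (concl (dpll cs [] \<sigma>))) + 2 \<le> N ^ 3"
    using set_concl_dpll[of cs "[]" \<sigma>] length_concl_dpll[OF dist, of "[]" \<sigma>] Nil N
    by (intro size_enc_clause_le) auto
  then show ?case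
    by (cases rule: find_cases[of "\<lambda>c. set c \<subseteq> set \<sigma>" cs]) auto
next
  case (Cons x xs \<sigma>)
  have size: "size (enc_clause (concl (dpll cs (x # xs) \<sigma>))) + 2 \<le> N ^ 3"
    using set_concl_dpll[of cs "x # xs" \<sigma>] length_concl_dpll[OF dist, of "x # xs" \<sigma>] Cons.prems N
    by (intro size_enc_clause_le) auto
  show ?case
  proof (cases rule: find_cases[of "\<lambda>c. set c \<subseteq> set \<sigma>" cs])
    case (Some c)
    with size show ?thesis
      by simp
  next
    case None
    have "size (enc_proof (dpll cs xs (l # \<sigma>))) \<le> calls cs xs (l # \<sigma>) * N ^ 3"
      if "l \<in> {Pos x, Neg x}" for l
      using Cons.prems that by (intro Cons.IH) auto
    from this[of "Pos x"] this[of "Neg x"] size None show ?thesis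
      by (auto simp: Let_def algebra_simps)
  qed
qed


lemma runs_main:
  fixes cs :: "nat literal list list"
  defines "Ks \<equiv> stars (map (map var) cs)"
  defines "xs \<equiv> snd (best (blocks Ks) [] [] (unions Ks))"
  assumes N: "64 \<le> N"
    and cs: "\<forall>c\<in>set cs. distinct c \<and> length c \<le> N \<and> (\<forall>l\<in>set c. var l + 2 \<le> N)" "length cs \<le> N"
    and Ks: "length (concat Ks) \<le> N"
    and xs: "\<forall>x\<in>set xs. x + 2 \<le> N" "length xs \<le> N"
  shows "runs f_main [enc_cnf cs] (enc_proof (dpll cs xs [])) (calls cs xs [] * N ^ 9 + N ^ 12)"
proof -
  interpret bounded_encoding enc_nat N
    using inj_enc_nat N by unfold_locales
  let ?b = "best (blocks Ks) [] [] (unions Ks)"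
  have len_Ks: "length Ks \<le> N"
    using length_stars[of "map (map var) cs"] cs(2) by (simp add: Ks_def)
  have bdd: "bounded (set (concat Ks))"
    using set_stars[of "map (map var) cs"] cs(1) by (fastforce simp: Ks_def bounded_def)
  then have bdd': "bounded (set (unions Ks))"
    by (simp add: set_unions)
  have len_U: "length (unions Ks) \<le> N"
    using length_unions[of Ks] Ks by linarith
  have "length (concat (blocks Ks)) = length (concat Ks)"
    using mset_concat_blocks[of Ks] by (metis size_mset)
  then have len_b: "length (concat (blocks Ks)) \<le> N"
    using Ks by simp
  have enc: "enc_cand r = Node (L (fst r)) (L (snd r))" for r
    by (cases r) simp
  obtain t1 where "call f_stars [enc_cnf cs] = Some (LL Ks, t1)" "t1 \<le> N ^ 11"
    using runs_stars[OF N _ cs(2)] cs(1) unfolding Ks_def by (fastforce elim: runsE)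
  moreover obtain t2 where "call f_blocks [LL Ks] = Some (LL (blocks Ks), t2)" "t2 \<le> N ^ 6"
    using runs_blocks[OF Ks len_Ks] by (rule runsE)
  moreover obtain t3 where "call f_unions [LL Ks] = Some (L (unions Ks), t3)" "t3 \<le> N ^ 9"
    using runs_unions[OF bdd Ks len_Ks] by (rule runsE)
  moreover obtain t4 where "call f_best [LL (blocks Ks), Atom, Atom, L (unions Ks)] = Some (enc_cand ?b, t4)"
    "t4 \<le> N ^ 10"
    using runs_best[OF bdd' len_U len_b length_blocks] by (rule runsE)
  moreover obtain t5 where "call f_solve [L xs, enc_clause [], enc_cnf cs] = Some (enc_proof (dpll cs xs []), t5)"
    "t5 \<le> calls cs xs [] * N ^ 9"
    using runs_solve[OF N cs, of xs "[]"] xs by (auto elim: runsE)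
  ultimately show ?thesis
    using N_powers
    by (simp add: runs_def call_unfold(1) main_body_def sem_simps enc xs_def enc_clause_def)
qed

lemma computes_refutation:
  fixes cs :: "nat literal list list"
  defines "Ks \<equiv> stars (map (map var) cs)"
  defines "xs \<equiv> snd (best (blocks Ks) [] [] (unions Ks))"
  assumes N: "64 \<le> N"
    and cs: "\<forall>c\<in>set cs. distinct c \<and> length c \<le> N \<and> (\<forall>l\<in>set c. var l + 2 \<le> N)" "length cs \<le> N"
    and Ks: "length (concat Ks) \<le> N"
    and xs: "\<forall>x\<in>set xs. x + 2 \<le> N" "length xs \<le> N"
  shows "\<exists>t. computes_in_time prog (enc_cnf cs) (enc_proof (dpll cs xs [])) t \<and> t \<le> calls cs xs [] * N ^ 13"
proof -
  obtain s where s: "call f_main [enc_cnf cs] = Some (enc_proof (dpll cs xs []), s)"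
    "s \<le> calls cs xs [] * N ^ 9 + N ^ 12"
    using runs_main[OF N cs Ks[unfolded Ks_def] xs[unfolded xs_def Ks_def]]
    unfolding xs_def Ks_def by (rule runsE)
  have size: "size (enc_proof (dpll cs xs [])) \<le> calls cs xs [] * N ^ 3"
    using size_enc_proof_le[OF N, of cs xs "[]"] cs xs by simp
  have "calls cs xs [] * N ^ 9 \<le> calls cs xs [] * N ^ 12" "calls cs xs [] * N ^ 3 \<le> calls cs xs [] * N ^ 12"
    using bound_sum(1)[OF N, of 9 12] bound_sum(1)[OF N, of 3 12] by simp_all
  moreover have "N ^ 12 \<le> calls cs xs [] * N ^ 12"
    using calls_pos[of cs xs "[]"] by simp
  moreover have "calls cs xs [] * (64 * N ^ 12) \<le> calls cs xs [] * N ^ 13"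
    using bound_sum(2)[OF N le_refl, of 12] by (intro mult_le_mono2) simp
  ultimately have "s + size (enc_proof (dpll cs xs [])) \<le> calls cs xs [] * N ^ 13"
    using s(2) size by linarith
  moreover have "computes_in_time prog (enc_cnf cs) (enc_proof (dpll cs xs []))
      (s + size (enc_proof (dpll cs xs [])))"
    using s(1) by (auto simp: computes_in_time_def call_def sem_eq_Some_iff prog_def)
  ultimately show ?thesis
    by blast
qed

section \<open>Guarantees of the algorithm on numbered formulas\<close>

lemma count_list_distinct: "distinct xs \<Longrightarrow> count_list xs x = (if x \<in> set xs then 1 else 0)"
  by (induction xs) auto

text \<open>As the sets are pairwise different, occurrences in the concatenation count stars. This
  carries the bound of two endpoints per edge over to the blocks.\<close>

lemma count_list_concat_distinct:
  assumes "\<forall>K\<in>set Ks. distinct K" "distinct (map set Ks)"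
  shows "count_list (concat Ks) x = card {S \<in> set ` set Ks. x \<in> S}"
  using assms
proof (induction Ks)
  case (Cons K Ks)
  have "{S \<in> set ` set (K # Ks). x \<in> S} =
      (if x \<in> set K then insert (set K) {S \<in> set ` set Ks. x \<in> S} else {S \<in> set ` set Ks. x \<in> S})"
    by auto
  moreover have "set K \<notin> set ` set Ks"
    using Cons.prems(2) by simp
  moreover have "count_list K x = (if x \<in> set K then 1 else 0)"
    using Cons.prems(1) by (simp add: count_list_distinct)
  ultimately show ?case
    using Cons by simp
qed simp

lemma distinct_unions: "\<forall>K\<in>set Ks. distinct K \<Longrightarrow> distinct (unions Ks)"
  by (induction Ks) (auto simp: unions_def union_def)

text \<open>Isolates what the algorithm exploits in a Tseitin formula: unsatisfiability, short
  clauses over numbered variables, and at most two clause supports per variable, one for each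
  endpoint. \<open>s\<close> is the smaller number of edges within a side.\<close>

lemma refutation_in_time:
  fixes cs :: "nat literal list list"
  assumes unsat: "\<And>\<alpha>. \<exists>c\<in>set cs. \<forall>l\<in>set c. \<not> sat_literal \<alpha> l"
    and clause: "\<forall>c\<in>set cs. distinct (map var c) \<and> length c \<le> D"
    and vars: "(\<Union>c\<in>set cs. var ` set c) = {..<m}"
    and two: "\<And>i. i < m \<Longrightarrow> card {S \<in> (\<lambda>c. var ` set c) ` set cs. i \<in> S} \<le> 2"
    and N: "length cs \<le> N" "64 * (m + 1) \<le> N"
  obtains R t s where "computes_in_time prog (enc_cnf cs) (enc_proof R) t"
    "tree_resolution_refutation (set ` set cs) (map_proof_tree set R)"
    "s \<le> m" "4 * m \<le> 20 * s + 15 * D" "t \<le> 4 * 2 ^ (m - s) * N ^ 13"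
proof -
  define Ks where "Ks = stars (map (map var) cs)"
  define U where "U = unions Ks"
  define xs where "xs = snd (best (blocks Ks) [] [] U)"
  define s where "s = length (fst (best (blocks Ks) [] [] U))"
  have Ks_sub: "\<exists>c\<in>set cs. K = map var c" if "K \<in> set Ks" for K
    using set_stars[of "map (map var) cs"] that by (auto simp: Ks_def)
  have dist_Ks: "\<forall>K\<in>set Ks. distinct K" and len_K: "\<forall>K\<in>set Ks. length K \<le> D"
    using Ks_sub clause by (metis length_map)+
  have set_Ks: "set ` set Ks \<subseteq> (\<lambda>c. var ` set c) ` set cs"
  proof
    fix S assume "S \<in> set ` set Ks"
    then obtain c where "c \<in> set cs" "S = set (map var c)"
      using Ks_sub by blast
    then show "S \<in> (\<lambda>c. var ` set c) ` set cs"
      by simp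
  qed
  have cover: "\<exists>K\<in>set Ks. var ` set c \<subseteq> set K" if "c \<in> set cs" for c
    using stars_cover[of "map var c" "map (map var) cs"] that by (simp add: Ks_def)
  have "\<Union> (set ` set Ks) = {..<m}"
  proof
    show "\<Union> (set ` set Ks) \<subseteq> {..<m}"
      unfolding vars[symmetric] using set_Ks by (rule Union_mono)
    show "{..<m} \<subseteq> \<Union> (set ` set Ks)"
      unfolding vars[symmetric] using cover by (intro UN_least) blast
  qed
  then have set_U: "set U = {..<m}" "set (concat Ks) = {..<m}"
    by (simp_all add: U_def set_unions)
  have dist_U: "distinct U"
    unfolding U_def using dist_Ks by (rule distinct_unions)
  have len_U: "length U = m"
    using distinct_card[OF dist_U] set_U by simp
  have count: "count_list (concat Ks) x \<le> 2" if "x < m" for x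
  proof -
    have "count_list (concat Ks) x = card {S \<in> set ` set Ks. x \<in> S}"
      using dist_Ks distinct_map_set_stars unfolding Ks_def by (rule count_list_concat_distinct)
    also have "\<dots> \<le> card {S \<in> (\<lambda>c. var ` set c) ` set cs. x \<in> S}"
      using set_Ks by (intro card_mono) (simp, blast)
    also have "\<dots> \<le> 2"
      using that by (rule two)
    finally show ?thesis .
  qed
  have "length (concat Ks) = (\<Sum>x\<in>set (concat Ks). count_list (concat Ks) x)"
    by (rule sum_count_set[symmetric]) auto
  also have "\<dots> \<le> (\<Sum>x\<in>set (concat Ks). 2)"
    using count set_U(2) by (intro sum_mono) blast
  finally have len_Ks: "length (concat Ks) \<le> 2 * m"
    unfolding set_U(2) by simp
  have mset: "mset (concat (blocks Ks)) = mset (concat Ks)"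
    by (rule mset_concat_blocks)
  have set_bs: "set (concat (blocks Ks)) = {..<m}"
    using arg_cong[OF mset, of set_mset] set_U(2) by simp
  have count_bs: "count_list (concat (blocks Ks)) x \<le> 2" if "x < m" for x
    using count[OF that] mset by (metis count_mset)
  obtain A B where AB: "(A, B) \<in> splits (blocks Ks) [] []" and best: "best (blocks Ks) [] [] U = cand U A B"
    using best_splits[of "blocks Ks" "[]" "[]" U] by blast
  define a where "a = filter (\<lambda>x. x \<notin> set B) U"
  define b where "b = filter (\<lambda>x. x \<notin> set A) U"
  define c where "c = filter (\<lambda>x. x \<notin> set b) (filter (\<lambda>x. x \<notin> set a) U)"
  have xs: "xs = c @ a @ b" and s: "s = min (length a) (length b)"
    unfolding xs_def s_def best cand_def a_def b_def c_def by (simp_all add: Let_def)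
  have "set A \<union> set B = {..<m}"
    using arg_cong[OF mset_splits[OF AB], of set_mset] set_bs by simp
  then have disj: "set a \<inter> set b = {}"
    using set_U(1) by (auto simp: a_def b_def)
  have sub: "set a \<subseteq> {..<m}" "set b \<subseteq> {..<m}"
    using set_U(1) by (auto simp: a_def b_def)
  have dist: "distinct xs"
    using dist_U disj by (auto simp: xs a_def b_def c_def)
  have set_xs: "set xs = {..<m}"
    using sub set_U(1) by (auto simp: xs c_def)
  have len_xs: "length c + length a + length b = m"
    using distinct_card[OF dist] set_xs by (simp add: xs)
  \<comment> \<open>A star lies within a block and so within a side. A clause touching
    \<open>a\<close> cannot lie in \<open>B\<close>, hence lies in \<open>A\<close>, which
    \<open>b\<close> avoids.\<close>
  have sep: "\<forall>C\<in>set cs. var ` set C \<inter> set a \<noteq> {} \<longrightarrow> var ` set C \<inter> set b = {}"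
  proof (intro ballI impI)
    fix C assume C: "C \<in> set cs" "var ` set C \<inter> set a \<noteq> {}"
    obtain K where K: "K \<in> set Ks" "var ` set C \<subseteq> set K"
      using cover[OF C(1)] by blast
    obtain bl where bl: "bl \<in> set (blocks Ks)" "set K \<subseteq> set bl"
      using blocks_cover[OF K(1)] by blast
    have "var ` set C \<subseteq> set A \<or> var ` set C \<subseteq> set B"
      using splits_cover[OF AB bl(1)] bl(2) K(2) by blast
    with C(2) have "var ` set C \<subseteq> set A"
      by (auto simp: a_def)
    then show "var ` set C \<inter> set b = {}"
      by (auto simp: b_def)
  qed
  have "calls cs xs [] \<le> 2 ^ length c * (2 ^ (length a + 1) + 2 ^ (length b + 1))"
    using calls_separated_le[OF sep, of c "[]"] by (simp add: xs)
  also have "\<dots> = 2 ^ (length c + length a + 1) + 2 ^ (length c + length b + 1)"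
    by (simp add: power_add algebra_simps)
  \<comment> \<open>Each exponent omits one of the two inner lists, and both have at least
    \<open>s\<close> elements.\<close>
  also have "\<dots> \<le> 2 ^ (m - s + 1) + 2 ^ (m - s + 1)"
    using len_xs s by (intro add_mono power_increasing) auto
  finally have calls: "calls cs xs [] \<le> 4 * 2 ^ (m - s)"
    by simp
  have "\<exists>t. computes_in_time prog (enc_cnf cs) (enc_proof (dpll cs xs [])) t \<and> t \<le> calls cs xs [] * N ^ 13"
    unfolding xs_def U_def Ks_def
  proof (rule computes_refutation)
    show "64 \<le> N" "length cs \<le> N"
      using N by auto
    show "\<forall>c\<in>set cs. distinct c \<and> length c \<le> N \<and> (\<forall>l\<in>set c. var l + 2 \<le> N)"
    proof
      fix c assume c: "c \<in> set cs"
      then have d: "distinct (map var c)" and v: "set (map var c) \<subseteq> {..<m}"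
        using clause vars by auto
      then have "length c \<le> m"
        using distinct_card[OF d] card_mono[OF finite_lessThan v] by simp
      then have "length c \<le> N"
        using N(2) by simp
      moreover have "var l + 2 \<le> N" if "l \<in> set c" for l
      proof -
        have "var l < m"
          using v that by auto
        then show ?thesis
          using N(2) by simp
      qed
      moreover have "distinct c"
        using d by (simp add: distinct_map)
      ultimately show "distinct c \<and> length c \<le> N \<and> (\<forall>l\<in>set c. var l + 2 \<le> N)"
        by blast
    qed
    show "length (concat (stars (map (map var) cs))) \<le> N"
      using len_Ks N(2) by (simp add: Ks_def)
    have "\<forall>x\<in>{..<m}. x + 2 \<le> N"
      using N(2) by auto
    moreover have "length xs \<le> N"
      using len_xs N(2) by (simp add: xs)
    ultimately show "\<forall>x\<in>set (snd (best (blocks (stars (map (map var) cs))) [] [] (unions (stars (map (map var) cs))))). x + 2 \<le> N"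
      "length (snd (best (blocks (stars (map (map var) cs))) [] [] (unions (stars (map (map var) cs))))) \<le> N"
      using set_xs unfolding xs_def U_def Ks_def by simp_all
  qed
  then obtain t where t: "computes_in_time prog (enc_cnf cs) (enc_proof (dpll cs xs [])) t"
    "t \<le> calls cs xs [] * N ^ 13"
    by blast
  show thesis
  proof (rule that)
    show "tree_resolution_refutation (set ` set cs) (map_proof_tree set (dpll cs xs []))"
      unfolding tree_resolution_refutation_def
    proof
      show "derivation (set ` set cs) (map_proof_tree set (dpll cs xs []))"
        using unsat
      proof (rule derivation_dpll)
        show "\<forall>c\<in>set cs. var ` set c \<subseteq> var ` set [] \<union> set xs"
          unfolding set_xs vars[symmetric] by auto
      qed
      show "concl (map_proof_tree set (dpll cs xs [])) = {}"
        using set_concl_dpll[of cs xs "[]"] by (simp add: concl_map_proof_tree)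
    qed
    show "s \<le> m"
      using s len_xs by simp
    show "4 * m \<le> 20 * s + 15 * D"
      unfolding s_def len_U[symmetric]
    proof (rule best_score)
      show "count_list (concat (blocks Ks)) x \<le> 2" if "x \<in> set U" for x
        using that count_bs set_U(1) by simp
      show "\<forall>b\<in>set (blocks Ks). \<forall>b'\<in>set (blocks Ks). length b \<le> length b' + D"
        using blocks_balanced[OF len_K] by blast
    qed (use dist_U set_U(1) set_bs in simp_all)
    have "calls cs xs [] * N ^ 13 \<le> 4 * 2 ^ (m - s) * N ^ 13"
      using calls by (rule mult_le_mono1)
    with t(2) show "t \<le> 4 * 2 ^ (m - s) * N ^ 13"
      by (rule le_trans)
  qed (rule t(1))
qed

section \<open>Stars in Tseitin formulas\<close>

lemma incident_subset: "incident E v \<subseteq> E"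
  by (auto simp: incident_def)

lemma finite_edges:
  assumes "simple_graph V E"
  shows "finite E"
  using assms finite_subset[of E "Pow V"] by (auto simp: simple_graph_def)

lemma card_incident_le:
  assumes "simple_graph V E" "v \<in> V"
  shows "card (incident E v) \<le> max_degree V E"
  using assms unfolding max_degree_def simple_graph_def by (intro Max_ge) auto

text \<open>Handshaking: summing all constraints counts every edge at both ends, and
  \<open>1 + 1 = 0\<close> in \<open>bit\<close>, so satisfied constraints force an even total
  charge.\<close>

lemma odd_charge_unsatisfied:
  assumes "simple_graph V E" "odd_charge V c"
  shows "\<exists>v\<in>V. \<not> vertex_constraint E c v x"
proof (rule ccontr)
  assume "\<not> ?thesis"
  then have "(\<Sum>v\<in>V. c v) = (\<Sum>v\<in>V. \<Sum>e\<in>incident E v. x e)"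
    by (intro sum.cong) (auto simp: vertex_constraint_def)
  also have "\<dots> = (\<Sum>v\<in>V. \<Sum>e\<in>E. if v \<in> e then x e else 0)"
    using finite_edges[OF assms(1)] by (simp add: incident_def sum.inter_filter)
  also have "\<dots> = (\<Sum>e\<in>E. \<Sum>v\<in>V. if v \<in> e then x e else 0)"
    by (rule sum.swap)
  also have "\<dots> = (\<Sum>e\<in>E. 0)"
  proof (rule sum.cong)
    fix e assume "e \<in> E"
    then have e: "e \<subseteq> V" "card e = 2"
      using assms(1) by (auto simp: simple_graph_def)
    have "(\<Sum>v\<in>V. if v \<in> e then x e else 0) = (\<Sum>v\<in>V \<inter> e. x e)"
      by (rule sum.inter_restrict[symmetric]) (use assms(1) in \<open>simp add: simple_graph_def\<close>)
    also have "\<dots> = (\<Sum>v\<in>e. x e)"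
      using e(1) by (simp add: Int_absorb1)
    also have "\<dots> = 0"
      using e(2) by simp
    finally show "(\<Sum>v\<in>V. if v \<in> e then x e else 0) = 0" .
  qed simp
  finally show False
    using assms(2) by (simp add: odd_charge_def)
qed

lemma sat_map_literal: "sat_literal \<alpha> (map_literal f l) \<longleftrightarrow> sat_literal (\<alpha> \<circ> f) l"
  by (cases l) auto

lemma rename_unsatisfied:
  assumes "simple_graph V E" "odd_charge V c"
  shows "\<exists>C\<in>rename f (tseitin V E c). \<forall>l\<in>C. \<not> sat_literal \<alpha> l"
proof -
  obtain C where "C \<in> tseitin V E c" "\<forall>l\<in>C. \<not> sat_literal (\<alpha> \<circ> f) l"
    using odd_charge_unsatisfied[OF assms, of "\<alpha> \<circ> f"] tseitin_satisfied_iff[of V E c "\<alpha> \<circ> f"] by blast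
  then show ?thesis
    by (intro bexI[of _ "map_literal f ` C"]) (auto simp: rename_def sat_map_literal)
qed

lemma var_map_literal [simp]: "var (map_literal f l) = f (var l)"
  by (cases l) auto

lemma var_falsified_clause: "var ` falsified_clause I x = I"
proof -
  have "(\<lambda>i. var (if x i = 1 then Neg i else Pos i)) = (\<lambda>i. i)"
    by auto
  then show ?thesis
    by (simp only: falsified_clause_def image_image image_ident)
qed

lemma inj_on_var_falsified_clause: "inj_on var (falsified_clause I x)"
  by (auto simp: falsified_clause_def inj_on_def)

lemma rename_clauseE:
  assumes "C \<in> rename \<nu> (tseitin V E c)"
  obtains v x where "v \<in> V" "\<not> vertex_constraint E c v x"
    "C = map_literal \<nu> ` falsified_clause (incident E v) x"
  using assms by (auto simp: rename_def tseitin_def)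

lemma var_rename_clause: "var ` map_literal \<nu> ` falsified_clause I x = \<nu> ` I"
proof -
  have "var ` map_literal \<nu> ` falsified_clause I x = \<nu> ` var ` falsified_clause I x"
    by (simp add: image_image)
  then show ?thesis
    by (simp add: var_falsified_clause)
qed

lemma inj_on_var_rename_clause:
  assumes "inj_on \<nu> I"
  shows "inj_on var (map_literal \<nu> ` falsified_clause I x)"
proof -
  have "inj_on \<nu> (var ` falsified_clause I x)"
    using assms by (simp add: var_falsified_clause)
  then have "inj_on (\<nu> \<circ> var) (falsified_clause I x)"
    by (intro comp_inj_on inj_on_var_falsified_clause)
  then show ?thesis
    by (auto simp: inj_on_def)
qed

text \<open>The zero assignment and the indicator of \<open>e\<close> have different parities at
  \<open>v\<close>. Hence every edge variable really occurs in the formula.\<close>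

lemma exists_violating:
  assumes "e \<in> incident E v" "finite E"
  shows "\<exists>x. \<not> vertex_constraint E c v x"
proof (cases "c v = 0")
  case True
  have "(\<Sum>i\<in>incident E v. if i = e then 1 else 0) = (1 :: bit)"
    using assms finite_subset[OF incident_subset] by (simp add: sum.delta)
  with True show ?thesis
    by (intro exI[of _ "\<lambda>i. if i = e then 1 else 0"]) (simp add: vertex_constraint_def)
next
  case False
  then show ?thesis
    by (intro exI[of _ "\<lambda>_. 0"]) (simp add: vertex_constraint_def)
qed

lemma vars_rename_tseitin:
  assumes "simple_graph V E" and bij: "bij_betw \<nu> E {..<m}"
  shows "(\<Union>C\<in>rename \<nu> (tseitin V E c). var ` C) = {..<m}"
proof
  show "(\<Union>C\<in>rename \<nu> (tseitin V E c). var ` C) \<subseteq> {..<m}"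
  proof (rule UN_least)
    fix C assume "C \<in> rename \<nu> (tseitin V E c)"
    then obtain v x where "C = map_literal \<nu> ` falsified_clause (incident E v) x"
      by (rule rename_clauseE)
    then have "var ` C = \<nu> ` incident E v"
      by (simp add: var_rename_clause)
    also have "\<dots> \<subseteq> \<nu> ` E"
      by (intro image_mono incident_subset)
    finally show "var ` C \<subseteq> {..<m}"
      using bij by (simp add: bij_betw_def)
  qed
  show "{..<m} \<subseteq> (\<Union>C\<in>rename \<nu> (tseitin V E c). var ` C)"
  proof
    fix i assume "i \<in> {..<m}"
    then have "i \<in> \<nu> ` E"
      using bij by (simp add: bij_betw_def)
    then obtain e where e: "e \<in> E" "i = \<nu> e"
      by blast
    have "card e = 2" "e \<subseteq> V"
      using assms(1) e(1) by (auto simp: simple_graph_def)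
    then have "e \<noteq> {}"
      by auto
    with \<open>e \<subseteq> V\<close> obtain v where v: "v \<in> e" "v \<in> V"
      by blast
    have "e \<in> incident E v"
      using e v by (simp add: incident_def)
    moreover obtain x where "\<not> vertex_constraint E c v x"
      using exists_violating[OF calculation finite_edges[OF assms(1)]] by blast
    then have "map_literal \<nu> ` falsified_clause (incident E v) x \<in> rename \<nu> (tseitin V E c)"
      using v by (auto simp: rename_def tseitin_def)
    ultimately show "i \<in> (\<Union>C\<in>rename \<nu> (tseitin V E c). var ` C)"
      unfolding e(2) by (intro UN_I) (auto simp only: var_rename_clause)
  qed
qed

text \<open>A clause mentioning the variable of \<open>e\<close> belongs to an endpoint of
  \<open>e\<close>, and all clauses of a vertex have the same variables.\<close>

lemma two_stars_per_variable:
  assumes "simple_graph V E" and bij: "bij_betw \<nu> E {..<m}" and "i < m"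
  shows "card {S \<in> (\<lambda>C. var ` C) ` rename \<nu> (tseitin V E c). i \<in> S} \<le> 2"
proof -
  have "i \<in> \<nu> ` E"
    using bij assms(3) by (simp add: bij_betw_def)
  then obtain e where e: "e \<in> E" "i = \<nu> e"
    by blast
  have card: "card e = 2"
    using assms(1) e(1) by (auto simp: simple_graph_def)
  have "{S \<in> (\<lambda>C. var ` C) ` rename \<nu> (tseitin V E c). i \<in> S} \<subseteq> (\<lambda>v. \<nu> ` incident E v) ` e"
  proof
    fix S assume "S \<in> {S \<in> (\<lambda>C. var ` C) ` rename \<nu> (tseitin V E c). i \<in> S}"
    then obtain C where C: "C \<in> rename \<nu> (tseitin V E c)" "i \<in> var ` C" "S = var ` C"
      by blast
    obtain v x where "C = map_literal \<nu> ` falsified_clause (incident E v) x"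
      using C(1) by (rule rename_clauseE)
    then have S: "var ` C = \<nu> ` incident E v"
      by (simp only: var_rename_clause)
    then obtain e' where e': "e' \<in> incident E v" "i = \<nu> e'"
      using C(2) by blast
    have "inj_on \<nu> E" "e' \<in> E" "\<nu> e' = \<nu> e"
      using bij_betw_imp_inj_on[OF bij] e(2) e' incident_subset[of E v] by auto
    then have "e' = e"
      using e(1) by (simp add: inj_on_eq_iff)
    then have "v \<in> e"
      using e' by (simp add: incident_def)
    with S C(3) show "S \<in> (\<lambda>v. \<nu> ` incident E v) ` e"
      by blast
  qed
  moreover have fin: "finite e"
    using card by (intro card_ge_0_finite) simp
  ultimately have "card {S \<in> (\<lambda>C. var ` C) ` rename \<nu> (tseitin V E c). i \<in> S} \<le>
      card ((\<lambda>v. \<nu> ` incident E v) ` e)"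
    by (intro card_mono) auto
  also have "\<dots> \<le> 2"
    using card_image_le[OF fin, of "\<lambda>v. \<nu> ` incident E v"] card by simp
  finally show ?thesis .
qed

lemma falsified_clause_eq: "falsified_clause I x = (\<lambda>i. if i \<in> {i \<in> I. x i = 1} then Neg i else Pos i) ` I"
  by (auto simp: falsified_clause_def)

lemma card_falsified_clauses:
  assumes "finite I"
  shows "finite (range (falsified_clause I))" "card (range (falsified_clause I)) \<le> 2 ^ card I"
proof -
  have sub: "range (falsified_clause I) \<subseteq> (\<lambda>J. (\<lambda>i. if i \<in> J then Neg i else Pos i) ` I) ` Pow I"
    using falsified_clause_eq[of I] by blast
  then show "finite (range (falsified_clause I))"
    by (rule finite_subset) (use assms in simp)
  have "card (range (falsified_clause I)) \<le> card ((\<lambda>J. (\<lambda>i. if i \<in> J then Neg i else Pos i) ` I) ` Pow I)"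
    using sub assms by (intro card_mono) auto
  also have "\<dots> \<le> card (Pow I)"
    using assms by (intro card_image_le) simp
  finally show "card (range (falsified_clause I)) \<le> 2 ^ card I"
    using assms by (simp add: card_Pow)
qed

text \<open>Isolated vertices may be arbitrarily many, so \<open>card V\<close> is no suitable
  measure. At most \<open>2 * card E\<close> vertices lie on edges, and the isolated ones can only
  contribute the empty clause, whence the \<open>+ 1\<close>.\<close>

lemma card_rename_tseitin:
  assumes "simple_graph V E"
  shows "card (rename \<nu> (tseitin V E c)) \<le> (2 * card E + 1) * 2 ^ max_degree V E"
proof -
  have fin: "finite V" "finite E" "finite (incident E v)" for v
    using assms finite_edges[OF assms] finite_subset[OF incident_subset] by (auto simp: simple_graph_def)
  define W where "W = \<Union> E"
  have W: "W \<subseteq> V"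
    using assms by (auto simp: W_def simple_graph_def)
  then have fin_W: "finite W"
    using fin(1) by (rule finite_subset)
  have "card W \<le> (\<Sum>e\<in>E. card e)"
    unfolding W_def by (rule card_Union_le_sum_card)
  also have "\<dots> = (\<Sum>e\<in>E. 2)"
    using assms by (intro sum.cong) (auto simp: simple_graph_def)
  finally have card_W: "card W \<le> 2 * card E"
    by simp
  have sub: "tseitin V E c \<subseteq> (\<Union>v\<in>W. range (falsified_clause (incident E v))) \<union> {{}}"
  proof
    fix C assume "C \<in> tseitin V E c"
    then obtain v x where C: "C = falsified_clause (incident E v) x"
      by (auto simp: tseitin_def)
    show "C \<in> (\<Union>v\<in>W. range (falsified_clause (incident E v))) \<union> {{}}"
    proof (cases "v \<in> W")
      case False
      then have "incident E v = {}"
        by (auto simp: incident_def W_def)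
      with C show ?thesis
        by (simp add: falsified_clause_def)
    qed (use C in blast)
  qed
  have fin': "finite ((\<Union>v\<in>W. range (falsified_clause (incident E v))) \<union> {{}})"
    using fin_W fin card_falsified_clauses(1) by auto
  have fin_T: "finite (tseitin V E c)"
    using sub fin' by (rule finite_subset)
  have "card (tseitin V E c) \<le> card ((\<Union>v\<in>W. range (falsified_clause (incident E v))) \<union> {{}})"
    using fin' sub by (rule card_mono)
  also have "\<dots> \<le> card (\<Union>v\<in>W. range (falsified_clause (incident E v))) + 1"
    using card_Un_le[of "\<Union>v\<in>W. range (falsified_clause (incident E v))" "{{}}"] by simp
  also have "card (\<Union>v\<in>W. range (falsified_clause (incident E v))) \<le>
      (\<Sum>v\<in>W. card (range (falsified_clause (incident E v))))"
    using fin_W by (rule card_UN_le)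
  also have "\<dots> \<le> (\<Sum>v\<in>W. 2 ^ max_degree V E)"
  proof (rule sum_mono)
    fix v assume "v \<in> W"
    then have "card (incident E v) \<le> max_degree V E"
      using W card_incident_le[OF assms] by blast
    then have "(2 :: nat) ^ card (incident E v) \<le> 2 ^ max_degree V E"
      by (rule power_increasing) simp
    then show "card (range (falsified_clause (incident E v))) \<le> 2 ^ max_degree V E"
      using card_falsified_clauses(2)[OF fin(3)] le_trans by blast
  qed
  also have "\<dots> \<le> 2 * card E * 2 ^ max_degree V E"
    using card_W by simp
  also have "2 * card E * 2 ^ max_degree V E + 1 \<le> (2 * card E + 1) * 2 ^ max_degree V E"
    by simp
  finally have "card (tseitin V E c) \<le> (2 * card E + 1) * 2 ^ max_degree V E"
    by simp
  moreover have "card (rename \<nu> (tseitin V E c)) \<le> card (tseitin V E c)"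
    unfolding rename_def using fin_T by (rule card_image_le)
  ultimately show ?thesis
    by linarith
qed

section \<open>Asymptotics\<close>

text \<open>The exponent is \<open>2 * sqrt 2 - 2\<close>. The lower bound makes room for the 0.8 of
  the search, the upper one leaves slack below 0.83.\<close>

lemma exponent_bounds:
  "0.8 \<le> 1 - 2 * (1 - 1 / sqrt 2)\<^sup>2" "1 - 2 * (1 - 1 / sqrt 2)\<^sup>2 \<le> (0.829 :: real)"
proof -
  have eq: "1 - 2 * (1 - 1 / sqrt 2)\<^sup>2 = 2 * sqrt 2 - (2 :: real)"
    by (simp add: power2_eq_square field_simps)
  have "1.4 \<le> sqrt 2"
    by (rule real_le_rsqrt) (simp add: power2_eq_square)
  moreover have "sqrt 2 \<le> (1.4145 :: real)"
    by (rule real_le_lsqrt) (simp_all add: power2_eq_square)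
  ultimately show "0.8 \<le> 1 - 2 * (1 - 1 / sqrt 2)\<^sup>2" "1 - 2 * (1 - 1 / sqrt 2)\<^sup>2 \<le> (0.829 :: real)"
    unfolding eq by simp_all
qed

lemma polynomial_factor_bigo: "(\<lambda>m. 4 * (64 * (real m + 1)) ^ 13) \<in> O(\<lambda>m. real m ^ 13)"
proof -
  have "(\<lambda>m. 64 * (real m + 1)) \<in> O(\<lambda>m. real m)"
    by (intro bigoI[of _ 128] eventually_sequentiallyI[of 1]) auto
  then have "(\<lambda>m. (64 * (real m + 1)) ^ 13) \<in> O(\<lambda>m. real m ^ 13)"
    by (rule landau_o.big_power)
  then show ?thesis
    by simp
qed

lemma power_smallo_powr:
  fixes a :: real
  assumes "0 < a"
  shows "(\<lambda>m. real m ^ k) \<in> o(\<lambda>m. 2 powr (a * real m))"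
proof (rule smalloI_tendsto)
  define c where "c = a * ln 2"
  have c: "0 < c"
    using assms by (simp add: c_def)
  have "filterlim (\<lambda>m. c * real m) at_top at_top"
    using c by (intro filterlim_tendsto_pos_mult_at_top[OF tendsto_const] filterlim_real_sequentially)
  then have "((\<lambda>m. (c * real m) ^ k / exp (c * real m)) \<longlongrightarrow> 0) at_top"
    by (rule filterlim_compose[OF tendsto_power_div_exp_0])
  from tendsto_mult_left[OF this, of "1 / c ^ k"]
  show "((\<lambda>m. real m ^ k / 2 powr (a * real m)) \<longlongrightarrow> 0) at_top"
    using assms by (simp add: power_mult_distrib powr_def c_def mult_ac)
qed simp

lemma eventually_time_bound:
  fixes h :: "nat \<Rightarrow> real"
  assumes "h \<in> o(\<lambda>m. real m)" and "a \<le> 0.829"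
  shows "\<forall>\<^sub>F m in at_top. 4 * (64 * (real m + 1)) ^ 13 * 2 powr (a * real m + h m) \<le> 2 powr (0.83 * real m)"
proof -
  \<comment> \<open>The gap between 0.829 and 0.83 is halved between \<open>h\<close> and the
    polynomial factor.\<close>
  have "\<forall>\<^sub>F m in at_top. norm (h m) \<le> 0.0005 * norm (real m)"
    using assms(1) by (rule landau_o.smallD) simp
  moreover have "(\<lambda>m. real m ^ 13) \<in> o(\<lambda>m. 2 powr (0.0005 * real m))"
    by (rule power_smallo_powr) simp
  from landau_o.smallD[OF landau_o.big_small_trans[OF polynomial_factor_bigo this], of 1]
  have "\<forall>\<^sub>F m in at_top. 4 * (64 * (real m + 1)) ^ 13 \<le> 2 powr (0.0005 * real m)"
    by simp
  ultimately show ?thesis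
  proof eventually_elim
    case (elim m)
    have "a * real m \<le> 0.829 * real m"
      using assms(2) by (intro mult_right_mono) auto
    then have le: "a * real m + h m \<le> 0.8295 * real m"
      using elim(1) by auto
    have "4 * (64 * (real m + 1)) ^ 13 * 2 powr (a * real m + h m) \<le>
        2 powr (0.0005 * real m) * 2 powr (0.8295 * real m)"
      using elim(2) le by (intro mult_mono powr_mono) auto
    also have "\<dots> = 2 powr (0.83 * real m)"
      by (simp flip: powr_add)
    finally show ?case .
  qed
qed

lemma smallo_id_of_smallo_sqrt:
  fixes d :: "nat \<Rightarrow> real"
  assumes "d \<in> o(\<lambda>m. sqrt (real m))"
  shows "(\<lambda>m. 14 * \<bar>d m\<bar>) \<in> o(\<lambda>m. real m)"
proof -
  have "(\<lambda>m. sqrt (real m)) \<in> O(\<lambda>m. real m)"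
    by (intro bigoI[of _ 1] eventually_sequentiallyI[of 1]) (auto intro!: real_le_lsqrt simp: power2_eq_square)
  with assms have "d \<in> o(\<lambda>m. real m)"
    by (rule landau_o.small_big_trans)
  then show ?thesis
    by simp
qed

lemma real_time_bound:
  fixes t m s D :: nat
  assumes t: "t \<le> 4 * 2 ^ (m - s) * (64 * (m + 1) * 2 ^ D) ^ 13"
    and s: "s \<le> m" "4 * m \<le> 20 * s + 15 * D"
    and a: "0.8 \<le> a" and D: "real D \<le> e"
  shows "real t \<le> 4 * (64 * (real m + 1)) ^ 13 * 2 powr (a * real m + 14 * e)"
proof -
  have "real t \<le> real (4 * 2 ^ (m - s) * (64 * (m + 1) * 2 ^ D) ^ 13)"
    using t of_nat_le_iff by blast
  also have "\<dots> = 4 * (64 * (real m + 1)) ^ 13 * (2 ^ (m - s) * (2 ^ D) ^ 13)"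
    by (simp only: of_nat_mult of_nat_power of_nat_add of_nat_numeral of_nat_1 power_mult_distrib ac_simps)
  also have "(2 :: real) ^ (m - s) * (2 ^ D) ^ 13 = 2 powr (real (m - s) + real (D * 13))"
    by (simp add: powr_add powr_realpow power_mult flip: of_nat_mult)
  \<comment> \<open>By the bound on \<open>s\<close>, m - s is at most 0.8 m + 0.75 D, and 13.75 D
    is at most 14 e.\<close>
  also have "real (m - s) + real (D * 13) \<le> a * real m + 14 * e"
  proof -
    have "4 * real m \<le> 20 * real s + 15 * real D"
      using s(2) by linarith
    moreover have "0.8 * real m \<le> a * real m"
      using a by (intro mult_right_mono) auto
    ultimately show ?thesis
      using s(1) D by (simp add: of_nat_diff)
  qed
  finally show ?thesis
    by simp
qed

theorem theorem5p5:
  shows "\<exists>(A :: program) (p :: nat \<Rightarrow> real) (k :: nat).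
    p \<in> O(\<lambda>m. real m ^ k) \<and>
    (\<forall>d :: nat \<Rightarrow> real. d \<in> o(\<lambda>m. sqrt (real m)) \<longrightarrow>
      (\<exists>h :: nat \<Rightarrow> real. h \<in> o(\<lambda>m. real m) \<and>
        (\<forall>(V :: nat set) (E :: nat set set) (c :: nat \<Rightarrow> bit) (\<nu> :: nat set \<Rightarrow> nat) cs.
          simple_graph V E \<longrightarrow> real (max_degree V E) \<le> d (card E) \<longrightarrow> odd_charge V c \<longrightarrow>
          bij_betw \<nu> E {..<card E} \<longrightarrow> lists_cnf cs (rename \<nu> (tseitin V E c)) \<longrightarrow>
          (\<exists>R t. computes_in_time A (enc_cnf cs) (enc_proof R) t \<and>
            tree_resolution_refutation (rename \<nu> (tseitin V E c)) (map_proof_tree set R) \<and>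
            real t \<le> p (card E) *
              2 powr ((1 - 2 * (1 - 1 / sqrt 2)\<^sup>2) * real (card E) + h (card E)))) \<and>
        (\<forall>\<^sub>F m in at_top. p m * 2 powr ((1 - 2 * (1 - 1 / sqrt 2)\<^sup>2) * real m + h m)
            \<le> 2 powr (0.83 * real m))))"
proof (rule exI[of _ prog], rule exI[of _ "\<lambda>m. 4 * (64 * (real m + 1)) ^ 13"], rule exI[of _ 13],
    intro conjI polynomial_factor_bigo allI impI)
  fix d :: "nat \<Rightarrow> real"
  assume d: "d \<in> o(\<lambda>m. sqrt (real m))"
  show "\<exists>h :: nat \<Rightarrow> real. h \<in> o(\<lambda>m. real m) \<and>
        (\<forall>(V :: nat set) (E :: nat set set) (c :: nat \<Rightarrow> bit) (\<nu> :: nat set \<Rightarrow> nat) cs.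
          simple_graph V E \<longrightarrow> real (max_degree V E) \<le> d (card E) \<longrightarrow> odd_charge V c \<longrightarrow>
          bij_betw \<nu> E {..<card E} \<longrightarrow> lists_cnf cs (rename \<nu> (tseitin V E c)) \<longrightarrow>
          (\<exists>R t. computes_in_time prog (enc_cnf cs) (enc_proof R) t \<and>
            tree_resolution_refutation (rename \<nu> (tseitin V E c)) (map_proof_tree set R) \<and>
            real t \<le> 4 * (64 * (real (card E) + 1)) ^ 13 *
              2 powr ((1 - 2 * (1 - 1 / sqrt 2)\<^sup>2) * real (card E) + h (card E)))) \<and>
        (\<forall>\<^sub>F m in at_top. 4 * (64 * (real m + 1)) ^ 13 *
            2 powr ((1 - 2 * (1 - 1 / sqrt 2)\<^sup>2) * real m + h m)
            \<le> 2 powr (0.83 * real m))"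
  proof (intro exI[of _ "\<lambda>m. 14 * \<bar>d m\<bar>"] conjI allI impI)
    show "(\<lambda>m. 14 * \<bar>d m\<bar>) \<in> o(\<lambda>m. real m)"
      using d by (rule smallo_id_of_smallo_sqrt)
    then show "\<forall>\<^sub>F m in at_top. 4 * (64 * (real m + 1)) ^ 13 *
        2 powr ((1 - 2 * (1 - 1 / sqrt 2)\<^sup>2) * real m + 14 * \<bar>d m\<bar>) \<le> 2 powr (0.83 * real m)"
      using exponent_bounds(2) by (rule eventually_time_bound)
  next
    fix V :: "nat set" and E :: "nat set set" and c :: "nat \<Rightarrow> bit" and \<nu> :: "nat set \<Rightarrow> nat" and cs
    assume G: "simple_graph V E" and deg: "real (max_degree V E) \<le> d (card E)"
      and odd: "odd_charge V c" and bij: "bij_betw \<nu> E {..<card E}"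
      and cs: "lists_cnf cs (rename \<nu> (tseitin V E c))"
    let ?F = "rename \<nu> (tseitin V E c)" and ?D = "max_degree V E" and ?m = "card E"
    have F: "set ` set cs = ?F" and dist: "distinct (map set cs)" "\<forall>C\<in>set cs. distinct C"
      using cs by (auto simp: lists_cnf_def)
    have clause: "\<forall>C\<in>set cs. distinct (map var C) \<and> length C \<le> ?D"
    proof
      fix C assume C: "C \<in> set cs"
      then have "set C \<in> ?F"
        using F by blast
      then obtain v x where v: "v \<in> V" and C_eq: "set C = map_literal \<nu> ` falsified_clause (incident E v) x"
        by (rule rename_clauseE)
      have "inj_on \<nu> (incident E v)"
        using bij_betw_imp_inj_on[OF bij] incident_subset by (rule inj_on_subset)
      then have "inj_on var (set C)"
        unfolding C_eq by (rule inj_on_var_rename_clause)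
      then have d: "distinct (map var C)"
        using dist(2) C by (simp add: distinct_map)
      have "length C = card (set (map var C))"
        using distinct_card[OF d] by simp
      also have "\<dots> = card (\<nu> ` incident E v)"
        using var_rename_clause[of \<nu> "incident E v" x] by (simp add: C_eq)
      also have "\<dots> \<le> card (incident E v)"
        using finite_subset[OF incident_subset finite_edges[OF G]] by (rule card_image_le)
      also have "\<dots> \<le> ?D"
        using G v by (rule card_incident_le)
      finally show "distinct (map var C) \<and> length C \<le> ?D"
        using d by blast
    qed
    \<comment> \<open>The number of clauses can be exponential in the maximum degree, so the size
      parameter \<open>N\<close> receives the factor \<open>2 ^ ?D\<close>.\<close>
    have "length cs = card ?F"
      using distinct_card[OF dist(1)] F by simp
    also have "\<dots> \<le> (2 * ?m + 1) * 2 ^ ?D"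
      using G by (rule card_rename_tseitin)
    also have "\<dots> \<le> 64 * (?m + 1) * 2 ^ ?D"
      by (rule mult_le_mono1) simp
    finally have len: "length cs \<le> 64 * (?m + 1) * 2 ^ ?D" .
    obtain R t s where R: "computes_in_time prog (enc_cnf cs) (enc_proof R) t"
      "tree_resolution_refutation (set ` set cs) (map_proof_tree set R)"
      and s: "s \<le> ?m" "4 * ?m \<le> 20 * s + 15 * ?D"
      and t: "t \<le> 4 * 2 ^ (?m - s) * (64 * (?m + 1) * 2 ^ ?D) ^ 13"
    proof (rule refutation_in_time[OF _ clause _ _ len])
      show "\<exists>C\<in>set cs. \<forall>l\<in>set C. \<not> sat_literal \<alpha> l" for \<alpha>
        using rename_unsatisfied[OF G odd, of \<nu> \<alpha>] F by (metis imageE)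
      show "(\<Union>C\<in>set cs. var ` set C) = {..<?m}"
        using vars_rename_tseitin[OF G bij, of c] unfolding F[symmetric] by simp
      show "card {S \<in> (\<lambda>C. var ` set C) ` set cs. i \<in> S} \<le> 2" if "i < ?m" for i
        using two_stars_per_variable[OF G bij that, of c] unfolding F[symmetric] image_image .
      show "64 * (?m + 1) \<le> 64 * (?m + 1) * 2 ^ ?D"
        by simp
    qed
    have "real t \<le> 4 * (64 * (real ?m + 1)) ^ 13 *
        2 powr ((1 - 2 * (1 - 1 / sqrt 2)\<^sup>2) * real ?m + 14 * \<bar>d ?m\<bar>)"
      using t s exponent_bounds(1) by (rule real_time_bound) (use deg in linarith)
    with R show "\<exists>R t. computes_in_time prog (enc_cnf cs) (enc_proof R) t \<and>
        tree_resolution_refutation ?F (map_proof_tree set R) \<and>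
        real t \<le> 4 * (64 * (real ?m + 1)) ^ 13 *
          2 powr ((1 - 2 * (1 - 1 / sqrt 2)\<^sup>2) * real ?m + 14 * \<bar>d ?m\<bar>)"
      unfolding F by blast
  qed
qed

end
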